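(* Let $n\ge 3$, let $\Omega\subset\mathbb{R}^n$ be a nonempty connected open set with the Euclidean metric, and let $\varphi$ be a limiting Carleman weight (LCW) in $\Omega$. Then there are $a\in\mathbb{R}\setminus\{0\}$, $b\in\mathbb{R}$ and $x_0\in\mathbb{R}^n$ such that $$\varphi(x)=a\,\psi(x-x_0)+b\qquad (x\in\Omega),$$ where $\psi$ is one of the following six functions, and the conformal Killing vector field $X=|\nabla\psi|^{-2}\nabla\psi$ of $\psi$ is the one indicated: 1. $\psi(x)=\gamma\cdot x$, with $X=(0,0,0,\gamma)$; 2. $\psi(x)=\log|x|$, with $X=(0,1,0,0)$; 3. $\psi(x)=\arctan\frac{\gamma\cdot x}{\sigma\cdot x}$, with $X=(0,0,\gamma\wedge\sigma,0)$; 4. $\psi(x)=-2\,\frac{\gamma\cdot x}{|x|^2}$, with $X=(\gamma,0,0,0)$; 5. $\psi(x)=\frac{1}{\sqrt s}\arctan\frac{-2\gamma\cdot x/\sqrt s}{|x|^2/s-1}$, with $X=(\gamma,0,0,\frac s2\gamma)$; 6. $\psi(x)=\frac{1}{\sqrt s}\,\mathrm{arctanh}\,\frac{-2\gamma\cdot x/\sqrt s}{|x|^2/s+1}$, with $X=(\gamma,0,0,-\frac s2\gamma)$. Here $\gamma,\sigma\in\mathbb{R}^n$ satisfy $|\gamma|=|\sigma|=1$ and $\gamma\cdot\sigma=0$, and $s>0$.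
   Context: Limiting Carleman weight (LCW): a real-valued $\varphi\in C^\infty(M)$ on a Riemannian manifold $(M,g)$ of dimension $n\geq 3$ with $d\varphi\neq0$ everywhere and such that $\mathrm{Hess}_g\varphi(\nabla\varphi,\nabla\varphi)+\mathrm{Hess}_g\varphi(V,V)=0$ at every point $p$ and for every $V\in T_pM$ with $|V|=|\nabla\varphi|$, $\langle V,\nabla\varphi\rangle=0$ (equivalently, the Poisson bracket $\{\overline{p_\varphi},p_\varphi\}$ vanishes on $\{p_\varphi=0\}$, where $p_\varphi(x,\xi)=|\xi|^2-|d\varphi|^2+2i\langle\xi,d\varphi\rangle$). Equivalently, $d\varphi\ne0$ everywhere and $|\nabla\varphi|^{-2}\nabla\varphi$ is a conformal Killing vector field. For $\alpha,\gamma\in\mathbb{R}^n$, $c\in\mathbb{R}$ and a skew-symmetric $n\times n$ matrix $B$, the notation $X=(\alpha,c,B,\gamma)$ means the vector field $X(x)=(\alpha\cdot x)x-\frac12\alpha|x|^2+cx+Bx+\gamma$; every conformal Killing vector field on a connected open subset of $\mathbb{R}^n$, $n\ge3$, has this form. For vectors, $\gamma\wedge\sigma$ is the skew-symmetric matrix $(\gamma_j\sigma_k-\sigma_j\gamma_k)_{j,k}$. Convention: $\arctan\frac{u}{v}$ for functions $u,v$ without common zeros means a smooth branch of the angle, i.e. a smooth function $\theta$ with $v=\sqrt{u^2+v^2}\cos\theta$ and $u=\sqrt{u^2+v^2}\sin\theta$. *)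

theory Defs
  imports "HOL-Analysis.Analysis"
begin

text \<open>Used only on open sets, where the Frechet derivative is unique.\<close>

primrec Ck_on :: "nat \<Rightarrow> ('a::real_normed_vector) set \<Rightarrow> ('a \<Rightarrow> 'b::real_normed_vector) \<Rightarrow> bool" where
  "Ck_on 0 S f \<longleftrightarrow> continuous_on S f"
| "Ck_on (Suc k) S f \<longleftrightarrow>
     (\<forall>x\<in>S. f differentiable (at x)) \<and>
     (\<forall>v. Ck_on k S (\<lambda>x. frechet_derivative f (at x) v))"

definition smooth_on :: "('a::real_normed_vector) set \<Rightarrow> ('a \<Rightarrow> 'b::real_normed_vector) \<Rightarrow> bool" where
  "smooth_on S f \<longleftrightarrow> (\<forall>k. Ck_on k S f)"

definition grad :: "(real^'n \<Rightarrow> real) \<Rightarrow> real^'n \<Rightarrow> real^'n" where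
  "grad f x = (\<chi> i. frechet_derivative f (at x) (axis i 1))"

definition Hess :: "(real^'n \<Rightarrow> real) \<Rightarrow> real^'n \<Rightarrow> real^'n \<Rightarrow> real^'n \<Rightarrow> real" where
  "Hess f x v w = frechet_derivative (\<lambda>y. frechet_derivative f (at y) v) (at x) w"

text \<open>Limiting Carleman weights on an open set of Euclidean space; for the Euclidean metric
  the Riemannian Hessian is the second derivative.\<close>

definition LCW :: "(real^'n) set \<Rightarrow> (real^'n \<Rightarrow> real) \<Rightarrow> bool" where
  "LCW \<Omega> \<phi> \<longleftrightarrow> smooth_on \<Omega> \<phi> \<and>
     (\<forall>p\<in>\<Omega>. grad \<phi> p \<noteq> 0 \<and>
        (\<forall>V. norm V = norm (grad \<phi> p) \<and> V \<bullet> grad \<phi> p = 0 \<longrightarrow>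
             Hess \<phi> p (grad \<phi> p) (grad \<phi> p) + Hess \<phi> p V V = 0))"

text \<open>The vector field written \<open>(\<alpha>, c, B, \<gamma>)\<close>; it is conformal Killing when \<open>B\<close> is skew-symmetric.\<close>

definition ckvf :: "real^'n \<Rightarrow> real \<Rightarrow> real^'n^'n \<Rightarrow> real^'n \<Rightarrow> real^'n \<Rightarrow> real^'n" where
  "ckvf \<alpha> c B \<gamma> x =
     (\<alpha> \<bullet> x) *\<^sub>R x - (1/2 * (norm x)^2) *\<^sub>R \<alpha> + c *\<^sub>R x + B *v x + \<gamma>"

definition wedge :: "real^'n \<Rightarrow> real^'n \<Rightarrow> real^'n^'n" where
  "wedge \<gamma> \<sigma> = (\<chi> j k. \<gamma>$j * \<sigma>$k - \<sigma>$j * \<gamma>$k)"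

text \<open>\<open>\<theta>\<close> is a smooth branch of \<open>arctan (u/v)\<close> on \<open>S\<close>, i.e. of the argument of \<open>v + i u\<close>;
  it may differ from the principal value of \<open>arctan (u/v)\<close>, and \<open>v\<close> may vanish where \<open>u\<close> does not.\<close>

definition arctan_branch ::
    "(real^'n) set \<Rightarrow> (real^'n \<Rightarrow> real) \<Rightarrow> (real^'n \<Rightarrow> real) \<Rightarrow> (real^'n \<Rightarrow> real) \<Rightarrow> bool" where
  "arctan_branch S u v \<theta> \<longleftrightarrow> smooth_on S \<theta> \<and>
     (\<forall>x\<in>S. \<not> (u x = 0 \<and> v x = 0) \<and>
        v x = sqrt ((u x)^2 + (v x)^2) * cos (\<theta> x) \<and>
        u x = sqrt ((u x)^2 + (v x)^2) * sin (\<theta> x))"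

text \<open>\<open>\<psi>\<close> is one of the six model weights, with parameters \<open>\<gamma>\<close>, \<open>\<sigma>\<close>, \<open>s\<close>, and \<open>X\<close> is the field attached
  to it. \<open>D\<close> is the domain of \<open>\<psi>\<close>: the natural one where \<open>\<psi>\<close> is given by a closed formula, and
  otherwise any set carrying a smooth branch of the angle.\<close>

definition model_weight ::
    "real^'n \<Rightarrow> real^'n \<Rightarrow> real \<Rightarrow> (real^'n) set \<Rightarrow> (real^'n \<Rightarrow> real) \<Rightarrow> (real^'n \<Rightarrow> real^'n) \<Rightarrow> bool" where
  "model_weight \<gamma> \<sigma> s D \<psi> X \<longleftrightarrow>
     (D = UNIV \<and> \<psi> = (\<lambda>x. \<gamma> \<bullet> x) \<and> X = ckvf 0 0 0 \<gamma>)
   \<or> (D = - {0} \<and> \<psi> = (\<lambda>x. ln (norm x)) \<and> X = ckvf 0 1 0 0)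
   \<or> (arctan_branch D (\<lambda>x. \<gamma> \<bullet> x) (\<lambda>x. \<sigma> \<bullet> x) \<psi> \<and> X = ckvf 0 0 (wedge \<gamma> \<sigma>) 0)
   \<or> (D = - {0} \<and> \<psi> = (\<lambda>x. - 2 * ((\<gamma> \<bullet> x) / (norm x)^2)) \<and> X = ckvf \<gamma> 0 0 0)
   \<or> (\<exists>\<theta>. arctan_branch D (\<lambda>x. - 2 * (\<gamma> \<bullet> x) / sqrt s) (\<lambda>x. (norm x)^2 / s - 1) \<theta> \<and>
          \<psi> = (\<lambda>x. 1 / sqrt s * \<theta> x) \<and> X = ckvf \<gamma> 0 0 ((s/2) *\<^sub>R \<gamma>))
   \<or> (D = {x. \<bar>(- 2 * (\<gamma> \<bullet> x) / sqrt s) / ((norm x)^2 / s + 1)\<bar> < 1} \<and>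
      \<psi> = (\<lambda>x. 1 / sqrt s * artanh ((- 2 * (\<gamma> \<bullet> x) / sqrt s) / ((norm x)^2 / s + 1))) \<and>
      X = ckvf \<gamma> 0 0 (- (s/2) *\<^sub>R \<gamma>))"

end

theory Submission
  imports Defs
begin

text \<open>
  Everything is read off from the field \<open>X = |\<nabla>\<phi>|\<^sup>-\<^sup>2 \<nabla>\<phi>\<close>, which determines \<open>\<phi>\<close> up to a constant because
  \<open>\<nabla>\<phi> = X / |X|\<^sup>2\<close>. Two things are known about \<open>X\<close>. Since the Hessian of \<open>\<phi>\<close> is a multiple of the metric
  on the orthogonal complement of \<open>\<nabla>\<phi>\<close>, with the opposite value in the normal direction, \<open>X\<close> is conformal
  Killing (\<open>lcw_field_conformal\<close>). Since \<open>X\<close> is a multiple of a gradient, it satisfies the Frobenius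
  condition: the 3-form \<open>X \<and> dX\<close> vanishes (\<open>lcw_field_integrable\<close>).

  The first property makes \<open>X\<close> quadratic, by Liouville's argument (\<open>conformal_field_quadratic\<close>): the
  conformal Killing equation \<open>\<partial>\<^sub>i X\<^sub>j + \<partial>\<^sub>j X\<^sub>i = 2 \<mu> \<delta>\<^sub>i\<^sub>j\<close> expresses all second derivatives of \<open>X\<close> by first
  derivatives of \<open>\<mu>\<close>, and the symmetry of the third derivatives then forces the Hessian of \<open>\<mu>\<close> to vanish as
  soon as three different indices are available. So \<open>X = (\<alpha>, c, B, \<gamma>)\<close> around a base point.

  For such a field \<open>dX\<close> at \<open>x\<close> is twice the skew matrix \<open>x \<and> \<alpha> + B\<close>, and the Frobenius condition becomes a
  polynomial identity of degree at most three in \<open>x\<close>; it holds on a ball, hence coefficientwise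
  (\<open>frobenius_coeffs\<close>). If \<open>\<alpha> \<noteq> 0\<close>, the quadratic coefficient yields \<open>B = z \<and> \<alpha>\<close> for some \<open>z\<close>, so a translation
  removes both \<open>B\<close> and \<open>c\<close>, after which the linear coefficient makes \<open>\<gamma>\<close> parallel to \<open>\<alpha>\<close>; the sign of the
  factor separates three of the models. If \<open>\<alpha> = 0\<close> and \<open>B \<noteq> 0\<close>, the linear coefficient yields \<open>c = 0\<close> and
  that \<open>B\<close> has rank two, and the constant one that \<open>\<gamma>\<close> lies in the image of \<open>B\<close>, so a translation removes
  \<open>\<gamma>\<close>. The remaining fields are dilations and constant fields (\<open>integrable_ckvf_normal_form\<close>).

  It remains to integrate \<open>X / |X|\<^sup>2\<close>. Where the model is a closed formula, it has the right gradient wherever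
  \<open>X\<close> does not vanish. Where it is an angle, the branch need not exist beyond the given domain, and \<open>\<phi>\<close>
  itself, rescaled and shifted by a constant, is shown to be one (\<open>smooth_potential_arctan_branch\<close>).
\<close>

section \<open>Directional derivatives and smooth real functions\<close>

definition dirderiv :: "'a \<Rightarrow> ('a::real_normed_vector \<Rightarrow> real) \<Rightarrow> 'a \<Rightarrow> real" where
  "dirderiv v f x = frechet_derivative f (at x) v"

lemma dirderiv_eqI: "(f has_derivative f') (at x) \<Longrightarrow> dirderiv v f x = f' v"
  unfolding dirderiv_def by (metis frechet_derivative_at)

lemma has_derivative_dirderiv:
  "f differentiable (at x) \<Longrightarrow> (f has_derivative (\<lambda>v. dirderiv v f x)) (at x)"
  unfolding dirderiv_def by (simp add: frechet_derivative_works[symmetric])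

lemma dirderiv_cong:
  assumes "open S" "x \<in> S" "\<And>y. y \<in> S \<Longrightarrow> f y = g y" "f differentiable (at x)"
  shows "dirderiv v f x = dirderiv v g x"
  unfolding dirderiv_def using frechet_derivative_transform_within_open[of f x S g] assms by metis

lemma differentiable_cong:
  assumes "open S" "x \<in> S" "\<And>y. y \<in> S \<Longrightarrow> f y = g y" "f differentiable (at x)"
  shows "g differentiable (at x)"
  using assms has_derivative_transform_within_open[of f _ x UNIV S g]
  unfolding differentiable_def by auto

lemma dirderiv_add:
  assumes "f differentiable (at x)" "g differentiable (at x)"
  shows "dirderiv v (\<lambda>x. f x + g x) x = dirderiv v f x + dirderiv v g x"
  by (rule dirderiv_eqI, rule has_derivative_add[OF has_derivative_dirderiv[OF assms(1)] has_derivative_dirderiv[OF assms(2)]])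

lemma dirderiv_mult:
  assumes "f differentiable (at x)" "g differentiable (at x)"
  shows "dirderiv v (\<lambda>x. f x * g x) x = f x * dirderiv v g x + dirderiv v f x * g x"
  by (rule dirderiv_eqI, rule has_derivative_mult[OF has_derivative_dirderiv[OF assms(1)] has_derivative_dirderiv[OF assms(2)]])

lemma dirderiv_inverse:
  assumes "f differentiable (at x)" "f x \<noteq> 0"
  shows "dirderiv v (\<lambda>x. inverse (f x)) x = - (inverse (f x) * dirderiv v f x * inverse (f x))"
  by (rule dirderiv_eqI) (rule Deriv.has_derivative_inverse[OF assms(2) has_derivative_dirderiv[OF assms(1)]])

lemma dirderiv_const [simp]: "dirderiv v (\<lambda>x. c) x = 0"
  by (rule dirderiv_eqI) simp

lemma dirderiv_sum:
  assumes "\<And>i. i \<in> I \<Longrightarrow> f i differentiable (at x)"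
  shows "dirderiv v (\<lambda>x. \<Sum>i\<in>I. f i x) x = (\<Sum>i\<in>I. dirderiv v (f i) x)"
  by (rule dirderiv_eqI, rule has_derivative_sum, rule has_derivative_dirderiv) (use assms in auto)

lemma dirderiv_linear:
  assumes "f differentiable (at x)"
  shows "linear (\<lambda>v. dirderiv v f x)"
  using has_derivative_dirderiv[OF assms] has_derivative_linear by blast

lemma dirderiv_diff:
  assumes "f differentiable (at x)" "g differentiable (at x)"
  shows "dirderiv v (\<lambda>x. f x - g x) x = dirderiv v f x - dirderiv v g x"
  by (rule dirderiv_eqI, rule has_derivative_diff[OF has_derivative_dirderiv[OF assms(1)] has_derivative_dirderiv[OF assms(2)]])

lemma dirderiv_mult_const:
  assumes "f differentiable (at x)"
  shows "dirderiv v (\<lambda>x. f x * c) x = dirderiv v f x * c"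
  using dirderiv_mult[OF assms, of "\<lambda>x. c"] by simp

lemma dirderiv_axis_sum:
  fixes f :: "real^'n \<Rightarrow> real"
  assumes "f differentiable (at x)"
  shows "dirderiv v f x = (\<Sum>i\<in>UNIV. v $ i * dirderiv (axis i 1) f x)"
proof -
  interpret linear "\<lambda>v. dirderiv v f x" by (rule dirderiv_linear[OF assms])
  have "dirderiv v f x = dirderiv (\<Sum>i\<in>UNIV. v $ i *\<^sub>R axis i 1) f x"
    using basis_expansion[of v] by (simp add: scalar_mult_eq_scaleR)
  then show ?thesis by (simp add: sum scale)
qed

lemma dirderiv_eq_grad:
  fixes f :: "real^'n \<Rightarrow> real"
  assumes "f differentiable (at x)"
  shows "dirderiv v f x = grad f x \<bullet> v"
  using dirderiv_axis_sum[OF assms, of v] by (simp add: grad_def inner_vec_def dirderiv_def mult.commute)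

lemma has_derivative_shift:
  assumes "(f has_derivative f') (at (x + a))"
  shows "((\<lambda>x. f (x + a)) has_derivative f') (at x)"
  using assms
  by (intro has_derivative_compose[where g = f and f = "\<lambda>x. x + a" and f' = "\<lambda>v. v"])
     (auto intro!: derivative_eq_intros)

lemma Ck_on_Suc_dirderiv:
  fixes f :: "'a::real_normed_vector \<Rightarrow> real"
  shows "Ck_on (Suc k) S f \<longleftrightarrow> (\<forall>x\<in>S. f differentiable (at x)) \<and> (\<forall>v. Ck_on k S (dirderiv v f))"
  by (simp add: dirderiv_def[abs_def])

text \<open>Closure of \<open>Ck_on\<close> under products and inverses needs this: the product rule for \<open>f * g\<close> at order
  \<open>k + 1\<close> contains the undifferentiated factors, which enter the induction at order \<open>k\<close>.\<close>

lemma Ck_on_SucD: "Ck_on (Suc k) S f \<Longrightarrow> Ck_on k S f"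
proof (induction k arbitrary: f)
  case 0
  then have "f differentiable_on S"
    by (simp add: differentiable_at_imp_differentiable_on)
  then show ?case by (simp add: differentiable_imp_continuous_on)
next
  case (Suc k)
  from Suc.prems Suc.IH show ?case by (metis Ck_on.simps(2))
qed

lemma Ck_on_cong:
  fixes f g :: "'a::real_normed_vector \<Rightarrow> real"
  assumes "open S" "\<And>x. x \<in> S \<Longrightarrow> f x = g x" "Ck_on k S f"
  shows "Ck_on k S g"
  using assms(2,3)
proof (induction k arbitrary: f g)
  case 0
  then show ?case using continuous_on_cong[of S S f g] by simp
next
  case (Suc k)
  have "Ck_on k S (dirderiv v g)" for v
    using Suc.IH[of "dirderiv v f" "dirderiv v g"] Suc.prems dirderiv_cong[OF assms(1)]
    unfolding Ck_on_Suc_dirderiv by metis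
  then show ?case using Suc.prems differentiable_cong[OF assms(1)]
    unfolding Ck_on_Suc_dirderiv by metis
qed

lemma Ck_on_const: "Ck_on k S (\<lambda>x. c::real)"
  by (induction k arbitrary: c) (simp_all add: Ck_on_Suc_dirderiv dirderiv_def frechet_derivative_const)

lemma Ck_on_add:
  fixes f g :: "'a::real_normed_vector \<Rightarrow> real"
  assumes "open S" "Ck_on k S f" "Ck_on k S g"
  shows "Ck_on k S (\<lambda>x. f x + g x)"
  using assms(2,3)
proof (induction k arbitrary: f g)
  case 0 then show ?case by (auto intro: continuous_intros)
next
  case (Suc k)
  then have d: "\<forall>x\<in>S. f differentiable (at x)" "\<forall>x\<in>S. g differentiable (at x)"
    and c: "Ck_on k S (dirderiv v f)" "Ck_on k S (dirderiv v g)" for v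
    unfolding Ck_on_Suc_dirderiv by auto
  have "Ck_on k S (dirderiv v (\<lambda>x. f x + g x))" for v
    by (rule Ck_on_cong[OF assms(1) _ Suc.IH[OF c]]) (simp add: dirderiv_add d)
  then show ?case unfolding Ck_on_Suc_dirderiv using d by auto
qed

lemma Ck_on_mult:
  fixes f g :: "'a::real_normed_vector \<Rightarrow> real"
  assumes "open S" "Ck_on k S f" "Ck_on k S g"
  shows "Ck_on k S (\<lambda>x. f x * g x)"
  using assms(2,3)
proof (induction k arbitrary: f g)
  case 0 then show ?case by (auto intro: continuous_intros)
next
  case (Suc k)
  then have d: "\<forall>x\<in>S. f differentiable (at x)" "\<forall>x\<in>S. g differentiable (at x)"
    and c: "Ck_on k S (dirderiv v f)" "Ck_on k S (dirderiv v g)" for v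
    unfolding Ck_on_Suc_dirderiv by auto
  have "Ck_on k S (dirderiv v (\<lambda>x. f x * g x))" for v
    by (rule Ck_on_cong[OF assms(1) _ Ck_on_add[OF assms(1) Suc.IH[OF Ck_on_SucD[OF Suc.prems(1)] c(2)[of v]] Suc.IH[OF c(1)[of v] Ck_on_SucD[OF Suc.prems(2)]]]])
       (simp add: dirderiv_mult d)
  then show ?case unfolding Ck_on_Suc_dirderiv using d by auto
qed

lemma Ck_on_inverse:
  fixes f :: "'a::real_normed_vector \<Rightarrow> real"
  assumes "open S" "Ck_on k S f" and nz: "\<And>x. x \<in> S \<Longrightarrow> f x \<noteq> 0"
  shows "Ck_on k S (\<lambda>x. inverse (f x))"
  using assms(2,3)
proof (induction k)
  case 0 then show ?case by (auto intro: continuous_intros)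
next
  case (Suc k)
  then have d: "\<forall>x\<in>S. f differentiable (at x)"
    and c: "Ck_on k S (dirderiv v f)" for v
    unfolding Ck_on_Suc_dirderiv by auto
  have i: "Ck_on k S (\<lambda>x. inverse (f x))"
    using Suc Ck_on_SucD by blast
  have "Ck_on k S (dirderiv v (\<lambda>x. inverse (f x)))" for v
    by (rule Ck_on_cong[OF assms(1) _ Ck_on_mult[OF assms(1) Ck_on_const[of _ _ "-1"] Ck_on_mult[OF assms(1) i Ck_on_mult[OF assms(1) c[of v] i]]]])
       (simp add: dirderiv_inverse d Suc.prems mult.assoc)
  then show ?case unfolding Ck_on_Suc_dirderiv using d Suc.prems by auto
qed

lemma
  fixes f :: "'a::real_normed_vector \<Rightarrow> real"
  assumes "smooth_on S f"
  shows smooth_on_differentiable: "x \<in> S \<Longrightarrow> f differentiable (at x)"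
    and smooth_on_dirderiv: "smooth_on S (dirderiv v f)"
  using assms Ck_on_Suc_dirderiv unfolding smooth_on_def by blast+

lemma smooth_on_isCont:
  fixes f :: "'a::real_normed_vector \<Rightarrow> real"
  shows "smooth_on S f \<Longrightarrow> x \<in> S \<Longrightarrow> isCont f x"
  using smooth_on_differentiable differentiable_imp_continuous_within by blast

lemma smooth_on_cong:
  fixes f g :: "'a::real_normed_vector \<Rightarrow> real"
  assumes "open S" "\<And>x. x \<in> S \<Longrightarrow> f x = g x" "smooth_on S f"
  shows "smooth_on S g"
  using assms Ck_on_cong[of S f g] unfolding smooth_on_def by blast

lemma smooth_on_const: "smooth_on S (\<lambda>x. c::real)"
  by (simp add: smooth_on_def Ck_on_const)

lemma smooth_on_add:
  fixes f g :: "'a::real_normed_vector \<Rightarrow> real"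
  shows "open S \<Longrightarrow> smooth_on S f \<Longrightarrow> smooth_on S g \<Longrightarrow> smooth_on S (\<lambda>x. f x + g x)"
  by (simp add: smooth_on_def Ck_on_add)

lemma smooth_on_mult:
  fixes f g :: "'a::real_normed_vector \<Rightarrow> real"
  shows "open S \<Longrightarrow> smooth_on S f \<Longrightarrow> smooth_on S g \<Longrightarrow> smooth_on S (\<lambda>x. f x * g x)"
  by (simp add: smooth_on_def Ck_on_mult)

lemma smooth_on_inverse:
  fixes f :: "'a::real_normed_vector \<Rightarrow> real"
  shows "open S \<Longrightarrow> smooth_on S f \<Longrightarrow> (\<And>x. x \<in> S \<Longrightarrow> f x \<noteq> 0) \<Longrightarrow> smooth_on S (\<lambda>x. inverse (f x))"
  by (simp add: smooth_on_def Ck_on_inverse)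

lemma smooth_on_sum:
  fixes f :: "'i \<Rightarrow> 'a::real_normed_vector \<Rightarrow> real"
  assumes "open S" "finite I" "\<And>i. i \<in> I \<Longrightarrow> smooth_on S (f i)"
  shows "smooth_on S (\<lambda>x. \<Sum>i\<in>I. f i x)"
  using assms(2,3)
  by (induction I rule: finite_induct) (simp_all add: smooth_on_const smooth_on_add assms(1))

lemma smooth_on_translate:
  fixes f :: "'a::real_normed_vector \<Rightarrow> real"
  assumes "open S" "smooth_on S f"
  shows "smooth_on ((\<lambda>x. x - a) ` S) (\<lambda>x. f (x + a))"
proof -
  have op: "open ((\<lambda>x. x - a) ` S)"
    using open_translation_subtract[OF assms(1)] .
  have "Ck_on k ((\<lambda>x. x - a) ` S) (\<lambda>x. f (x + a))" if "Ck_on k S f" for k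
    using that
  proof (induction k arbitrary: f)
    case 0
    then show ?case by (auto intro!: continuous_on_compose2[of S f] continuous_intros)
  next
    case (Suc k)
    have *: "((\<lambda>x. f (x + a)) has_derivative (\<lambda>v. dirderiv v f (x + a))) (at x)"
      if "f differentiable (at (x + a))" for x
      by (rule has_derivative_shift[OF has_derivative_dirderiv[OF that]])
    have d: "f differentiable (at (x + a))" if "x \<in> (\<lambda>x. x - a) ` S" for x
      using Suc.prems that unfolding Ck_on_Suc_dirderiv by auto
    have eq: "dirderiv v f (x + a) = dirderiv v (\<lambda>x. f (x + a)) x" if "x \<in> (\<lambda>x. x - a) ` S" for v x
      using dirderiv_eqI[OF *[OF d[OF that]]] by simp
    have "Ck_on k S (dirderiv v f)" for v
      using Suc.prems unfolding Ck_on_Suc_dirderiv by blast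
    then have "Ck_on k ((\<lambda>x. x - a) ` S) (dirderiv v (\<lambda>x. f (x + a)))" for v
      by (intro Ck_on_cong[OF op eq] Suc.IH)
    moreover have "(\<lambda>x. f (x + a)) differentiable (at x)" if "x \<in> (\<lambda>x. x - a) ` S" for x
      using differentiableI[OF *[OF d[OF that]]] .
    ultimately show ?case
      unfolding Ck_on_Suc_dirderiv by blast
  qed
  then show ?thesis using assms unfolding smooth_on_def by blast
qed

section \<open>Symmetry of second derivatives\<close>

text \<open>The mean value theorem is applied in direction \<open>v\<close> to the difference of \<open>f\<close> along the two sides of
  the parallelogram parallel to \<open>v\<close>, then in direction \<open>w\<close> to the derivative so obtained.\<close>

lemma second_difference_mean_value:
  fixes f :: "'a::real_normed_vector \<Rightarrow> real"
  assumes h: "h > 0" "h * (norm v + norm w) < r"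
    and f: "\<And>y. y \<in> ball x r \<Longrightarrow> f differentiable (at y)"
    and g: "\<And>y. y \<in> ball x r \<Longrightarrow> dirderiv v f differentiable (at y)"
  shows "\<exists>z\<in>ball x r. f (x + h *\<^sub>R v + h *\<^sub>R w) - f (x + h *\<^sub>R v) - f (x + h *\<^sub>R w) + f x
                     = h * h * dirderiv w (dirderiv v f) z"
proof -
  have inb: "x + t *\<^sub>R v + s *\<^sub>R w \<in> ball x r" if "0 \<le> t" "t \<le> h" "0 \<le> s" "s \<le> h" for t s
  proof -
    have "norm (t *\<^sub>R v + s *\<^sub>R w) \<le> t * norm v + s * norm w"
      using norm_triangle_ineq[of "t *\<^sub>R v" "s *\<^sub>R w"] that by simp
    also have "\<dots> \<le> h * (norm v + norm w)"
      using that by (simp add: distrib_left add_mono mult_right_mono)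
    also have "norm (t *\<^sub>R v + s *\<^sub>R w) = dist x (x + t *\<^sub>R v + s *\<^sub>R w)"
      by (metis add.assoc add_diff_cancel_left' dist_commute dist_norm)
    finally show ?thesis using h by simp
  qed
  have line: "((\<lambda>t. k (c + t *\<^sub>R u)) has_real_derivative dirderiv u k (c + t *\<^sub>R u)) (at t)"
    if "k differentiable (at (c + t *\<^sub>R u))" for k :: "'a \<Rightarrow> real" and c u t
  proof -
    have "((\<lambda>t. k (c + t *\<^sub>R u)) has_derivative (\<lambda>s. dirderiv (s *\<^sub>R u) k (c + t *\<^sub>R u))) (at t)"
      using that
      by (intro has_derivative_compose[where g = k and f = "\<lambda>t. c + t *\<^sub>R u" and f' = "\<lambda>s. s *\<^sub>R u"] has_derivative_dirderiv)
         (auto intro!: derivative_eq_intros)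
    moreover have "dirderiv (s *\<^sub>R u) k (c + t *\<^sub>R u) = dirderiv u k (c + t *\<^sub>R u) * s" for s
      using linear_scale[OF dirderiv_linear[OF that]] by simp
    ultimately show ?thesis
      by (simp add: has_field_derivative_def)
  qed
  have "\<exists>t. 0 < t \<and> t < h \<and> (f ((x + h *\<^sub>R w) + h *\<^sub>R v) - f (x + h *\<^sub>R v)) - (f ((x + h *\<^sub>R w) + 0 *\<^sub>R v) - f (x + 0 *\<^sub>R v))
     = (h - 0) * (dirderiv v f ((x + h *\<^sub>R w) + t *\<^sub>R v) - dirderiv v f (x + t *\<^sub>R v))"
    using h(1)
  proof (rule MVT2)
    fix t assume t: "0 \<le> t" "t \<le> h"
    then show "((\<lambda>t. f (x + h *\<^sub>R w + t *\<^sub>R v) - f (x + t *\<^sub>R v)) has_real_derivative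
      dirderiv v f (x + h *\<^sub>R w + t *\<^sub>R v) - dirderiv v f (x + t *\<^sub>R v)) (at t)"
    proof (intro DERIV_diff line f)
      show "x + h *\<^sub>R w + t *\<^sub>R v \<in> ball x r"
        using inb[of t h] t h(1) by (simp add: add.commute add.left_commute)
      show "x + t *\<^sub>R v \<in> ball x r"
        using inb[of t 0] t h(1) by simp
    qed
  qed
  then obtain t where t: "0 < t" "t < h"
    and 1: "f (x + h *\<^sub>R v + h *\<^sub>R w) - f (x + h *\<^sub>R v) - f (x + h *\<^sub>R w) + f x = h * (dirderiv v f (x + t *\<^sub>R v + h *\<^sub>R w) - dirderiv v f (x + t *\<^sub>R v))"
    by (auto simp: add.commute add.left_commute)
  have "\<exists>s. 0 < s \<and> s < h \<and> dirderiv v f (x + t *\<^sub>R v + h *\<^sub>R w) - dirderiv v f (x + t *\<^sub>R v + 0 *\<^sub>R w)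
     = (h - 0) * dirderiv w (dirderiv v f) (x + t *\<^sub>R v + s *\<^sub>R w)"
    using h(1)
  proof (rule MVT2)
    fix s assume s: "0 \<le> s" "s \<le> h"
    show "((\<lambda>s. dirderiv v f (x + t *\<^sub>R v + s *\<^sub>R w)) has_real_derivative
       dirderiv w (dirderiv v f) (x + t *\<^sub>R v + s *\<^sub>R w)) (at s)"
      using inb[of t s] s t by (intro line g) auto
  qed
  then obtain s where s: "0 < s" "s < h"
    "dirderiv v f (x + t *\<^sub>R v + h *\<^sub>R w) - dirderiv v f (x + t *\<^sub>R v) = h * dirderiv w (dirderiv v f) (x + t *\<^sub>R v + s *\<^sub>R w)"
    by auto
  show ?thesis
    using 1 s t inb[of t s] by (intro bexI[of _ "x + t *\<^sub>R v + s *\<^sub>R w"]) auto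
qed

text \<open>The second difference is symmetric in \<open>v\<close> and \<open>w\<close>, so the two mixed derivatives agree at two points
  that are arbitrarily close to \<open>x\<close>; continuity does the rest.\<close>

lemma dirderiv_commute:
  fixes f :: "'a::real_normed_vector \<Rightarrow> real"
  assumes "open S" "smooth_on S f" "x \<in> S"
  shows "dirderiv v (dirderiv w f) x = dirderiv w (dirderiv v f) x"
proof (rule ccontr)
  assume ne: "dirderiv v (dirderiv w f) x \<noteq> dirderiv w (dirderiv v f) x"
  define e where "e = \<bar>dirderiv v (dirderiv w f) x - dirderiv w (dirderiv v f) x\<bar> / 2"
  have "e > 0" using ne by (simp add: e_def)
  have near: "\<exists>r>0. \<forall>y. dist y x < r \<longrightarrow> \<bar>g y - g x\<bar> < e" if "smooth_on S g" for g :: "'a \<Rightarrow> real"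
    using smooth_on_isCont[OF that assms(3)] \<open>e > 0\<close>
    unfolding continuous_at_eps_delta dist_real_def by blast
  obtain r1 where r1: "r1 > 0" "\<And>y. dist y x < r1 \<Longrightarrow> \<bar>dirderiv v (dirderiv w f) y - dirderiv v (dirderiv w f) x\<bar> < e"
    using near[OF smooth_on_dirderiv[OF smooth_on_dirderiv[OF assms(2)]]] by blast
  obtain r2 where r2: "r2 > 0" "\<And>y. dist y x < r2 \<Longrightarrow> \<bar>dirderiv w (dirderiv v f) y - dirderiv w (dirderiv v f) x\<bar> < e"
    using near[OF smooth_on_dirderiv[OF smooth_on_dirderiv[OF assms(2)]]] by blast
  obtain r3 where r3: "r3 > 0" "ball x r3 \<subseteq> S"
    using assms(1,3) openE by blast
  define r where "r = min r1 (min r2 r3)"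
  have r: "r > 0" "ball x r \<subseteq> S" using r1(1) r2(1) r3 by (auto simp: r_def)
  define h where "h = r / (norm v + norm w + 1)"
  have n: "norm v + norm w + 1 > 0" by (simp add: add_nonneg_pos)
  have h: "h > 0" "h * (norm v + norm w) < r"
    using r n by (simp_all add: h_def divide_less_eq algebra_simps)
  have d: "g differentiable (at y)" if "smooth_on S g" "y \<in> ball x r" for g :: "'a \<Rightarrow> real" and y
    using that r smooth_on_differentiable by blast
  have d1: "\<And>y. y \<in> ball x r \<Longrightarrow> f differentiable (at y)"
    and d2: "\<And>y u. y \<in> ball x r \<Longrightarrow> dirderiv u f differentiable (at y)"
    using d assms(2) smooth_on_dirderiv by blast+
  obtain z1 where z1: "z1 \<in> ball x r" "f (x + h *\<^sub>R v + h *\<^sub>R w) - f (x + h *\<^sub>R v) - f (x + h *\<^sub>R w) + f x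
                     = h * h * dirderiv w (dirderiv v f) z1"
    using second_difference_mean_value[where x = x and f = f, OF h(1) h(2) d1 d2] by blast
  have h': "h * (norm w + norm v) < r" using h by (simp add: add.commute)
  obtain z2 where z2: "z2 \<in> ball x r" "f (x + h *\<^sub>R w + h *\<^sub>R v) - f (x + h *\<^sub>R w) - f (x + h *\<^sub>R v) + f x
                     = h * h * dirderiv v (dirderiv w f) z2"
    using second_difference_mean_value[where x = x and f = f, OF h(1) h' d1 d2] by blast
  have "h * h * dirderiv w (dirderiv v f) z1 = h * h * dirderiv v (dirderiv w f) z2"
    using z1(2) z2(2) by (simp add: algebra_simps)
  then have "dirderiv w (dirderiv v f) z1 = dirderiv v (dirderiv w f) z2" using h(1) by simp
  moreover have "\<bar>dirderiv w (dirderiv v f) z1 - dirderiv w (dirderiv v f) x\<bar> < e" "\<bar>dirderiv v (dirderiv w f) z2 - dirderiv v (dirderiv w f) x\<bar> < e"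
    using r1(2)[of z2] r2(2)[of z1] z1(1) z2(1) by (simp_all add: r_def dist_commute)
  ultimately show False unfolding e_def by (simp add: abs_if split: if_splits)
qed

section \<open>Liouville's theorem for conformal Killing fields\<close>

lemma eq_if_partials_eq:
  fixes f g :: "real^'n \<Rightarrow> real"
  assumes "open S" "connected S"
    and f: "\<And>x. x \<in> S \<Longrightarrow> f differentiable (at x)"
    and g: "\<And>x. x \<in> S \<Longrightarrow> g differentiable (at x)"
    and eq: "\<And>x i. x \<in> S \<Longrightarrow> dirderiv (axis i 1) f x = dirderiv (axis i 1) g x"
    and "p \<in> S" "f p = g p" "x \<in> S"
  shows "f x = g x"
proof -
  have *: "((\<lambda>x. f x - g x) has_derivative (\<lambda>v. 0)) (at x)" if x: "x \<in> S" for x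
  proof -
    have "dirderiv v f x = dirderiv v g x" for v
      using dirderiv_axis_sum[OF f[OF x], of v] dirderiv_axis_sum[OF g[OF x], of v] eq[OF x] by simp
    then show ?thesis
      using has_derivative_diff[OF has_derivative_dirderiv[OF f[OF x]] has_derivative_dirderiv[OF g[OF x]]] by simp
  qed
  have "f x - g x = f p - g p"
    using has_derivative_zero_unique_connected[OF assms(1,2) * assms(8,6)] .
  then show ?thesis using assms(7) by simp
qed

lemma has_derivative_ckvf:
  "(ckvf \<alpha> c B \<gamma> has_derivative
     (\<lambda>v. (\<alpha> \<bullet> v) *\<^sub>R y + (\<alpha> \<bullet> y) *\<^sub>R v - (y \<bullet> v) *\<^sub>R \<alpha> + c *\<^sub>R v + B *v v)) (at y)"
proof -
  have B: "((*v) B has_derivative (*v) B) (at y)"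
    by (rule bounded_linear_imp_has_derivative) (simp add: matrix_vector_mul_bounded_linear)
  show ?thesis
    unfolding ckvf_def[abs_def] power2_norm_eq_inner
    by (rule derivative_eq_intros B refl)+ (simp add: algebra_simps inner_commute)
qed

lemma dirderiv_component:
  assumes "(F has_derivative F') (at x)"
  shows "dirderiv v (\<lambda>x. F x $ k) x = F' v $ k" "(\<lambda>x. F x $ k) differentiable (at x)"
proof -
  have *: "((\<lambda>x. F x $ k) has_derivative (\<lambda>v. F' v $ k)) (at x)"
    using bounded_linear.has_derivative[OF bounded_linear_vec_nth assms] .
  show "dirderiv v (\<lambda>x. F x $ k) x = F' v $ k" by (rule dirderiv_eqI[OF *])
  show "(\<lambda>x. F x $ k) differentiable (at x)" using differentiableI[OF *] .
qed

lemma exists_third_index: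
  assumes "CARD('n::finite) \<ge> 3"
  shows "\<exists>m::'n. m \<noteq> i \<and> m \<noteq> j"
proof -
  have "card {i, j} < CARD('n)"
    using card_insert_le_m1[of 2 "{j}" i] assms by (simp add: card_insert_if)
  then have "{i, j} \<noteq> UNIV" by (metis less_irrefl)
  then show ?thesis by auto
qed

text \<open>The constants are \<open>\<alpha> = \<nabla>\<mu>\<close>, \<open>c = \<mu> p\<close>, the skew part \<open>B\<close> of the derivative of \<open>X\<close> at \<open>p\<close>, and \<open>\<gamma> = X p\<close>.
  Once \<open>\<nabla>\<mu>\<close> is known to be constant, \<open>X\<close> and the quadratic field have the same second derivatives and the
  same 1-jet at \<open>p\<close>, and two applications of \<open>eq_if_partials_eq\<close> identify them.\<close>

lemma conformal_field_quadratic: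
  fixes X :: "real^'n \<Rightarrow> real^'n" and \<mu> :: "real^'n \<Rightarrow> real"
  assumes n3: "CARD('n) \<ge> 3" and \<Omega>: "open \<Omega>" "connected \<Omega>" "p \<in> \<Omega>"
    and sm: "\<And>k. smooth_on \<Omega> (\<lambda>x. X x $ k)"
    and conf: "\<And>x i j. x \<in> \<Omega> \<Longrightarrow> dirderiv (axis i 1) (\<lambda>x. X x $ j) x + dirderiv (axis j 1) (\<lambda>x. X x $ i) x
                 = \<mu> x * (if i = j then 2 else 0)"
  shows "\<exists>\<alpha> c B \<gamma>. (\<forall>u v. u \<bullet> (B *v v) = - (v \<bullet> (B *v u))) \<and> (\<forall>x\<in>\<Omega>. X x = ckvf \<alpha> c B \<gamma> (x - p))"
proof -
  define D :: "'n \<Rightarrow> (real^'n \<Rightarrow> real) \<Rightarrow> real^'n \<Rightarrow> real" where "D i f = dirderiv (axis i 1) f" for i f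
  define Y where "Y k x = X x $ k" for k x
  define \<delta> :: "'n \<Rightarrow> 'n \<Rightarrow> real" where "\<delta> i j = (if i = j then 1 else 0)" for i j
  have smY: "smooth_on \<Omega> (Y k)" for k using sm unfolding Y_def .
  have smD: "smooth_on \<Omega> (D i f)" if "smooth_on \<Omega> f" for i f
    unfolding D_def using smooth_on_dirderiv[OF that] .
  have df: "f differentiable (at x)" if "smooth_on \<Omega> f" "x \<in> \<Omega>" for f :: "real^'n \<Rightarrow> real" and x
    using smooth_on_differentiable that .
  have comm: "D i (D j f) x = D j (D i f) x" if "smooth_on \<Omega> f" "x \<in> \<Omega>" for i j f x
    unfolding D_def using dirderiv_commute[OF \<Omega>(1) that] .
  have conf': "D i (Y j) x + D j (Y i) x = \<mu> x * (2 * \<delta> i j)" if "x \<in> \<Omega>" for i j x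
    using conf[OF that, of i j] unfolding D_def Y_def \<delta>_def by auto
  have sm\<mu>: "smooth_on \<Omega> \<mu>"
  proof (rule smooth_on_cong[OF \<Omega>(1) _ smD[OF smY]])
    show "D i (Y i) x = \<mu> x" if "x \<in> \<Omega>" for i x
      using conf'[OF that, of i i] by (simp add: \<delta>_def)
  qed
  have S1: "D k (D i (Y j)) x + D k (D j (Y i)) x = D k \<mu> x * (2 * \<delta> i j)" if x: "x \<in> \<Omega>" for i j k x
  proof -
    have "D k (\<lambda>x. D i (Y j) x + D j (Y i) x) x = D k (\<lambda>x. \<mu> x * (2 * \<delta> i j)) x"
      unfolding D_def[of k]
      by (rule dirderiv_cong[OF \<Omega>(1) x]) (simp_all add: conf' df[OF smD[OF smY]] x)
    then show ?thesis
      using x by (simp add: D_def[of k] dirderiv_add dirderiv_mult_const df smD smY sm\<mu>)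
  qed
  \<comment> \<open>As for the Christoffel symbols of a metric, adding two cyclic permutations of \<open>S1\<close> and subtracting
      the third isolates one second derivative.\<close>
  have S2: "D i (D j (Y k)) x = D i \<mu> x * \<delta> j k + D j \<mu> x * \<delta> i k - D k \<mu> x * \<delta> i j"
    if x: "x \<in> \<Omega>" for i j k x
    using S1[OF x, of i j k] S1[OF x, of j i k] S1[OF x, of k i j]
      comm[OF smY x, of i j k] comm[OF smY x, of i k j] comm[OF smY x, of j k i] by linarith
  have S3: "D l (D i (D j (Y k))) x
      = D l (D i \<mu>) x * \<delta> j k + D l (D j \<mu>) x * \<delta> i k - D l (D k \<mu>) x * \<delta> i j"
    if x: "x \<in> \<Omega>" for i j k l x
  proof -
    have "D l (D i (D j (Y k))) x = D l (\<lambda>x. D i \<mu> x * \<delta> j k + D j \<mu> x * \<delta> i k - D k \<mu> x * \<delta> i j) x"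
      unfolding D_def[of l]
      by (rule dirderiv_cong[OF \<Omega>(1) x]) (simp_all add: S2 df[OF smD[OF smD[OF smY]]] x)
    then show ?thesis
      using x by (simp add: D_def[of l] dirderiv_add dirderiv_diff dirderiv_mult_const df smD sm\<mu>)
  qed
  have M0: "D l (D j \<mu>) x = 0" if x: "x \<in> \<Omega>" for l j x
  proof -
    define M where "M i j = D i (D j \<mu>) x" for i j
    \<comment> \<open>The formula \<open>S3\<close> is antisymmetrised in \<open>l\<close> and \<open>i\<close>.\<close>
    have E: "M l j * \<delta> i k - M l k * \<delta> i j = M i j * \<delta> l k - M i k * \<delta> l j" for i j k l
      using S3[OF x, of l i j k] S3[OF x, of i l j k] comm[OF smD[OF smY] x, of l i j k]
        arg_cong[OF comm[OF sm\<mu> x, of i l], of "\<lambda>m. m * \<delta> j k"]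
      unfolding M_def by linarith
    \<comment> \<open>The diagonal entries of \<open>M\<close> are pairwise opposite, which leaves only 0 for three of them.\<close>
    have neg: "M l l = - M i i" if "i \<noteq> l" for i l
      using E[of l l i i] that by (simp add: \<delta>_def)
    show "D l (D j \<mu>) x = 0"
    proof (cases "j = l")
      case True
      obtain i where i: "i \<noteq> l" using exists_third_index[OF n3] by metis
      obtain m where m: "m \<noteq> i" "m \<noteq> l" using exists_third_index[OF n3] by metis
      have "M l l = 0" using neg[OF i] neg[OF m(1)] neg[OF m(2)] neg[of l i] by linarith
      then show ?thesis using True by (simp add: M_def)
    next
      case False
      obtain i where i: "i \<noteq> l" "i \<noteq> j" using exists_third_index[OF n3] by metis
      show ?thesis using E[of l j i i] i False by (simp add: \<delta>_def M_def)
    qed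
  qed
  define \<alpha> where "\<alpha> = (\<chi> j. D j \<mu> p)"
  define c where "c = \<mu> p"
  define B where "B = (\<chi> k j. D j (Y k) p - c * \<delta> j k)"
  define \<gamma> where "\<gamma> = X p"
  have \<alpha>: "D j \<mu> x = \<alpha> $ j" if x: "x \<in> \<Omega>" for j x
    by (rule eq_if_partials_eq[OF \<Omega>(1,2) _ _ _ \<Omega>(3) _ x])
       (auto simp: \<alpha>_def df smD sm\<mu> M0[unfolded D_def] D_def intro!: df smooth_on_dirderiv sm\<mu>)
  have B\<delta>: "(B *v axis j 1) $ k = D j (Y k) p - c * \<delta> j k" for j k
    by (simp add: B_def matrix_vector_mul_component inner_axis)
  have skew: "B $ k $ j = - (B $ j $ k)" for j k
  proof -
    have "\<delta> k j = \<delta> j k" by (simp add: \<delta>_def)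
    moreover have "B $ k $ j = D j (Y k) p - \<mu> p * \<delta> j k" "B $ j $ k = D k (Y j) p - \<mu> p * \<delta> k j"
      by (simp_all add: B_def c_def)
    ultimately show ?thesis
      using conf'[OF \<Omega>(3), of j k] by simp
  qed
  have skew': "u \<bullet> (B *v v) = - (v \<bullet> (B *v u))" for u v
  proof -
    have "transpose B = - B"
      by (simp add: vec_eq_iff transpose_def) (intro allI skew)
    moreover have "u \<bullet> (B *v v) = v \<bullet> (transpose B *v u)"
      by (metis transpose_matrix_vector dot_lmul_matrix inner_commute)
    moreover have "(- B) *v u = - (B *v u)"
      using matrix_vector_mult_diff_rdistrib[of 0 B u] by simp
    ultimately show ?thesis by simp
  qed
  define F where "F x = ckvf \<alpha> c B \<gamma> (x - p)" for x
  have F: "(F has_derivative (\<lambda>v. (\<alpha> \<bullet> v) *\<^sub>R (x - p) + (\<alpha> \<bullet> (x - p)) *\<^sub>R v - ((x - p) \<bullet> v) *\<^sub>R \<alpha> + c *\<^sub>R v + B *v v)) (at x)" for x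
    unfolding F_def[abs_def]
    using has_derivative_shift[where a = "- p" and x = x, OF has_derivative_ckvf] by simp
  \<comment> \<open>\<open>E j k\<close> is the \<open>j\<close>-th partial derivative of the \<open>k\<close>-th component of \<open>F\<close>.\<close>
  define E where "E j k x = \<alpha> $ j * (x - p) $ k + (\<alpha> \<bullet> (x - p)) * \<delta> j k - (x - p) $ j * \<alpha> $ k + D j (Y k) p" for j k x
  have ax: "axis j 1 $ k = \<delta> j k" for j k
    by (simp add: axis_def \<delta>_def)
  have DF: "D j (\<lambda>x. F x $ k) x = E j k x" for j k x
    unfolding D_def[of _ "\<lambda>x. F x $ k"] dirderiv_component[OF F] E_def
    by (simp add: B\<delta> inner_axis ax)
  have E': "((\<lambda>x. E j k x) has_derivative (\<lambda>v. \<alpha> $ j * v $ k + (\<alpha> \<bullet> v) * \<delta> j k - v $ j * \<alpha> $ k)) (at x)" for j k x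
    unfolding E_def
    by (auto intro!: derivative_eq_intros bounded_linear_imp_has_derivative[OF bounded_linear_vec_nth])
  have Y1: "D j (Y k) x = E j k x" if x: "x \<in> \<Omega>" for j k x
  proof (rule eq_if_partials_eq[OF \<Omega>(1,2) _ _ _ \<Omega>(3) _ x])
    fix x i assume x: "x \<in> \<Omega>"
    show "D j (Y k) differentiable (at x)" by (intro df smD smY x)
    show "E j k differentiable (at x)" using differentiableI[OF E'] .
    have "dirderiv (axis i 1) (E j k) x = \<alpha> $ j * \<delta> i k + \<alpha> $ i * \<delta> j k - \<delta> i j * \<alpha> $ k"
      unfolding dirderiv_eqI[OF E'] by (simp add: inner_axis ax)
    then show "dirderiv (axis i 1) (D j (Y k)) x = dirderiv (axis i 1) (E j k) x"
      using S2[OF x, of i j k] \<alpha>[OF x] unfolding D_def by simp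
  qed (simp add: E_def)
  have "X x $ k = F x $ k" if x: "x \<in> \<Omega>" for x k
  proof (rule eq_if_partials_eq[where f = "\<lambda>x. X x $ k" and g = "\<lambda>x. F x $ k", OF \<Omega>(1,2) _ _ _ \<Omega>(3) _ x])
    fix x i assume x: "x \<in> \<Omega>"
    show "(\<lambda>x. X x $ k) differentiable (at x)" by (intro df sm x)
    show "(\<lambda>x. F x $ k) differentiable (at x)" by (rule dirderiv_component(2)[OF F])
    show "dirderiv (axis i 1) (\<lambda>x. X x $ k) x = dirderiv (axis i 1) (\<lambda>x. F x $ k) x"
      using Y1[OF x, of i k] DF[of i k x] unfolding D_def Y_def by simp
  qed (simp add: F_def ckvf_def \<gamma>_def)
  then have "\<forall>x\<in>\<Omega>. X x = ckvf \<alpha> c B \<gamma> (x - p)"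
    by (simp add: vec_eq_iff F_def)
  then show ?thesis using skew' by blast
qed

section \<open>The field of a limiting Carleman weight\<close>

text \<open>This is the pointwise content of the LCW condition. By homogeneity \<open>H\<close> is \<open>- H g g / |g|\<^sup>2\<close> times the
  metric on the complement of \<open>g\<close>. Splitting \<open>v\<close> along \<open>g\<close> gives the case \<open>v = w\<close>, and polarisation the
  general one. When \<open>g\<close> is a gradient field and \<open>H\<close> its derivative, the left-hand side is, up to a positive
  factor, the symmetrised derivative of \<open>g / |g|\<^sup>2\<close>.\<close>

lemma umbilic_bilinear:
  fixes H :: "'a::real_inner \<Rightarrow> 'a \<Rightarrow> real"
  assumes bil: "bilinear H" and sym: "\<And>v w. H v w = H w v" and g: "g \<noteq> 0"
    and umb: "\<And>V. norm V = norm g \<Longrightarrow> V \<bullet> g = 0 \<Longrightarrow> H g g + H V V = 0"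
  shows "(g \<bullet> g) * H v w - (g \<bullet> v) * H g w - (g \<bullet> w) * H g v = - (v \<bullet> w) * H g g"
proof -
  note bi = bilinear_ladd[OF bil] bilinear_radd[OF bil] bilinear_lmul[OF bil] bilinear_rmul[OF bil]
  have gg: "g \<bullet> g > 0" using g by simp
  have perp: "(g \<bullet> g) * H V V = - (V \<bullet> V) * H g g" if V: "V \<bullet> g = 0" for V
  proof (cases "V = 0")
    case True
    then show ?thesis using bilinear_lzero[OF bil] by simp
  next
    case False
    define t where "t = norm g / norm V"
    have "H g g + H (t *\<^sub>R V) (t *\<^sub>R V) = 0"
      by (rule umb) (use False V in \<open>simp_all add: t_def\<close>)
    then have "H g g + (t * t) * H V V = 0" by (simp add: bi)
    moreover have "(t * t) * (V \<bullet> V) = g \<bullet> g"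
      using False by (simp add: t_def power2_norm_eq_inner[symmetric] power2_eq_square)
    ultimately show ?thesis
      by (metis (no_types, opaque_lifting) add.commute add_eq_0_iff minus_mult_left mult.assoc mult.commute)
  qed
  have diag: "(g \<bullet> g) * H v v - 2 * (g \<bullet> v) * H g v = - (v \<bullet> v) * H g g" for v
  proof -
    define a where "a = (g \<bullet> v) / (g \<bullet> g)"
    define V where "V = v - a *\<^sub>R g"
    have a: "a * (g \<bullet> g) = g \<bullet> v" using gg by (simp add: a_def)
    have V: "V \<bullet> g = 0" using a by (simp add: V_def inner_diff_left inner_commute[of v g])
    have v: "v = V + a *\<^sub>R g" by (simp add: V_def)
    have 1: "H v v = H V V + 2 * a * H g V + a * a * H g g"
      unfolding v by (simp add: bi sym[of V g] algebra_simps)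
    have 2: "H g v = H g V + a * H g g" unfolding v by (simp add: bi)
    have 3: "v \<bullet> v = V \<bullet> V + a * a * (g \<bullet> g)"
      unfolding v using V by (simp add: algebra_simps inner_commute)
    show ?thesis
      unfolding 1 2 3 a[symmetric] using perp[OF V] by (simp add: algebra_simps)
  qed
  show ?thesis
    using diag[of "v + w"] diag[of v] diag[of w]
    by (simp add: bi sym[of w v] inner_add inner_commute[of w v] algebra_simps)
qed

definition lcw_field :: "(real^'n \<Rightarrow> real) \<Rightarrow> real^'n \<Rightarrow> real^'n" where
  "lcw_field \<phi> x = (1 / (norm (grad \<phi> x))^2) *\<^sub>R grad \<phi> x"

context
  fixes \<Omega> :: "(real^'n) set" and \<phi>
  assumes \<Omega>: "open \<Omega>" and sm: "smooth_on \<Omega> \<phi>" and nz: "\<And>x. x \<in> \<Omega> \<Longrightarrow> grad \<phi> x \<noteq> 0"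
begin

lemma norm_grad_smooth: "smooth_on \<Omega> (\<lambda>x. grad \<phi> x \<bullet> grad \<phi> x)"
proof -
  have "smooth_on \<Omega> (\<lambda>x. \<Sum>i\<in>UNIV. dirderiv (axis i 1) \<phi> x * dirderiv (axis i 1) \<phi> x)"
    by (intro smooth_on_sum smooth_on_mult \<Omega> smooth_on_dirderiv sm) simp
  then show ?thesis
    by (simp add: grad_def inner_vec_def dirderiv_def)
qed

lemma dirderiv_norm_grad:
  assumes x: "x \<in> \<Omega>"
  shows "dirderiv v (\<lambda>x. grad \<phi> x \<bullet> grad \<phi> x) x = 2 * Hess \<phi> x v (grad \<phi> x)"
proof -
  note d = smooth_on_differentiable[OF smooth_on_dirderiv[OF sm] x]
  have "dirderiv v (\<lambda>x. grad \<phi> x \<bullet> grad \<phi> x) x = dirderiv v (\<lambda>x. \<Sum>i\<in>UNIV. dirderiv (axis i 1) \<phi> x * dirderiv (axis i 1) \<phi> x) x"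
    by (simp add: grad_def inner_vec_def dirderiv_def[of _ \<phi>])
  also have "\<dots> = (\<Sum>i\<in>UNIV. 2 * (dirderiv (axis i 1) \<phi> x * dirderiv v (dirderiv (axis i 1) \<phi>) x))"
    by (subst dirderiv_sum) (simp_all add: dirderiv_mult d)
  also have "\<dots> = 2 * (\<Sum>i\<in>UNIV. grad \<phi> x $ i * dirderiv (axis i 1) (dirderiv v \<phi>) x)"
  proof -
    have "dirderiv v (dirderiv (axis i 1) \<phi>) x = dirderiv (axis i 1) (dirderiv v \<phi>) x" for i
      by (rule dirderiv_commute[OF \<Omega> sm x])
    moreover have "dirderiv (axis i 1) \<phi> x = grad \<phi> x $ i" for i
      by (simp add: grad_def dirderiv_def)
    ultimately show ?thesis by (simp only: sum_distrib_left)
  qed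
  also have "(\<Sum>i\<in>UNIV. grad \<phi> x $ i * dirderiv (axis i 1) (dirderiv v \<phi>) x) = dirderiv (grad \<phi> x) (dirderiv v \<phi>) x"
    by (rule dirderiv_axis_sum[OF d, symmetric])
  finally show ?thesis by (simp add: Hess_def dirderiv_def[abs_def])
qed

lemma lcw_field_inner:
  assumes x: "x \<in> \<Omega>"
  shows "lcw_field \<phi> x \<bullet> w = dirderiv w \<phi> x * inverse (grad \<phi> x \<bullet> grad \<phi> x)"
  using dirderiv_eq_grad[OF smooth_on_differentiable[OF sm x], of w]
  by (simp add: lcw_field_def power2_norm_eq_inner field_simps)

lemma smooth_lcw_field: "smooth_on \<Omega> (\<lambda>x. lcw_field \<phi> x \<bullet> w)"
proof (rule smooth_on_cong[OF \<Omega>])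
  show "smooth_on \<Omega> (\<lambda>x. dirderiv w \<phi> x * inverse (grad \<phi> x \<bullet> grad \<phi> x))"
    by (intro smooth_on_mult smooth_on_inverse \<Omega> smooth_on_dirderiv sm norm_grad_smooth) (simp add: nz)
qed (simp add: lcw_field_inner)

lemma dirderiv_lcw_field:
  assumes x: "x \<in> \<Omega>"
  defines "g \<equiv> grad \<phi> x"
  shows "dirderiv v (\<lambda>x. lcw_field \<phi> x \<bullet> w) x
     = Hess \<phi> x w v / (g \<bullet> g) - 2 * (g \<bullet> w) * Hess \<phi> x v g / (g \<bullet> g)^2"
proof -
  have "dirderiv v (\<lambda>x. lcw_field \<phi> x \<bullet> w) x = dirderiv v (\<lambda>x. dirderiv w \<phi> x * inverse (grad \<phi> x \<bullet> grad \<phi> x)) x"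
    by (rule dirderiv_cong[OF \<Omega> x]) (simp_all add: lcw_field_inner smooth_on_differentiable[OF smooth_lcw_field x])
  also have "\<dots> = dirderiv w \<phi> x * - (inverse (g \<bullet> g) * (2 * Hess \<phi> x v g) * inverse (g \<bullet> g)) + dirderiv v (dirderiv w \<phi>) x * inverse (g \<bullet> g)"
    unfolding g_def dirderiv_norm_grad[OF x, symmetric]
    by (subst dirderiv_mult)
       (simp_all add: dirderiv_inverse nz x smooth_on_differentiable[OF smooth_on_dirderiv[OF sm] x] smooth_on_differentiable[OF norm_grad_smooth x]
         smooth_on_differentiable[OF smooth_on_inverse[OF \<Omega> norm_grad_smooth] x])
  also have "dirderiv v (dirderiv w \<phi>) x = Hess \<phi> x w v" by (simp add: Hess_def dirderiv_def[abs_def])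
  also have "dirderiv w \<phi> x = g \<bullet> w" unfolding g_def by (rule dirderiv_eq_grad[OF smooth_on_differentiable[OF sm x]])
  finally show ?thesis by (simp add: field_simps power2_eq_square)
qed

lemma Hess_commute: "x \<in> \<Omega> \<Longrightarrow> Hess \<phi> x v w = Hess \<phi> x w v"
  using dirderiv_commute[OF \<Omega> sm, of x w v] by (simp add: Hess_def dirderiv_def[abs_def])

lemma bilinear_Hess:
  assumes x: "x \<in> \<Omega>" shows "bilinear (Hess \<phi> x)"
proof -
  have "linear (\<lambda>w. Hess \<phi> x v w)" for v
    using dirderiv_linear[OF smooth_on_differentiable[OF smooth_on_dirderiv[OF sm] x]]
    by (simp add: Hess_def dirderiv_def[abs_def])
  then show ?thesis unfolding bilinear_def using Hess_commute[OF x] by simp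
qed

text \<open>The Frobenius condition \<open>X \<and> dX = 0\<close>. The Hessian is symmetric, so it cancels from \<open>dX\<close>, and what remains
  is the wedge product of \<open>\<nabla>\<phi>\<close> with another covector; its wedge product with \<open>X\<close>, a multiple of \<open>\<nabla>\<phi>\<close>, is
  zero.\<close>

lemma lcw_field_integrable:
  assumes x: "x \<in> \<Omega>"
  defines "d \<equiv> \<lambda>v w. dirderiv v (\<lambda>x. lcw_field \<phi> x \<bullet> w) x - dirderiv w (\<lambda>x. lcw_field \<phi> x \<bullet> v) x"
  shows "(lcw_field \<phi> x \<bullet> u) * d v w + (lcw_field \<phi> x \<bullet> v) * d w u + (lcw_field \<phi> x \<bullet> w) * d u v = 0"
proof -
  define g where "g = grad \<phi> x"
  define N where "N = g \<bullet> g"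
  have "N \<noteq> 0" using nz[OF x] by (simp add: N_def g_def)
  have d: "d v w = 2 * ((g \<bullet> v) * Hess \<phi> x w g - (g \<bullet> w) * Hess \<phi> x v g) / N^2" for v w
    unfolding d_def dirderiv_lcw_field[OF x] g_def[symmetric] N_def[symmetric] Hess_commute[OF x, of w v]
    by (simp add: field_simps diff_divide_distrib)
  have X: "lcw_field \<phi> x \<bullet> u = (g \<bullet> u) / N" for u
    by (simp add: lcw_field_def g_def N_def power2_norm_eq_inner)
  show ?thesis unfolding d X using \<open>N \<noteq> 0\<close> by (simp add: field_simps)
qed

lemma lcw_field_conformal:
  assumes x: "x \<in> \<Omega>"
    and umb: "\<And>V. norm V = norm (grad \<phi> x) \<Longrightarrow> V \<bullet> grad \<phi> x = 0 \<Longrightarrow>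
                Hess \<phi> x (grad \<phi> x) (grad \<phi> x) + Hess \<phi> x V V = 0"
  defines "\<mu> \<equiv> - Hess \<phi> x (grad \<phi> x) (grad \<phi> x) / (norm (grad \<phi> x))^4"
  shows "dirderiv v (\<lambda>x. lcw_field \<phi> x \<bullet> w) x + dirderiv w (\<lambda>x. lcw_field \<phi> x \<bullet> v) x = \<mu> * (2 * (v \<bullet> w))"
proof -
  define g where "g = grad \<phi> x"
  define N where "N = g \<bullet> g"
  have N: "N \<noteq> 0" using nz[OF x] by (simp add: N_def g_def)
  have N4: "(norm g)^4 = N^2"
    unfolding N_def power2_norm_eq_inner[symmetric] by simp
  have *: "N * Hess \<phi> x v w - (g \<bullet> v) * Hess \<phi> x g w - (g \<bullet> w) * Hess \<phi> x g v = - (v \<bullet> w) * Hess \<phi> x g g"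
    unfolding N_def g_def
    by (rule umbilic_bilinear[OF bilinear_Hess[OF x] Hess_commute[OF x] nz[OF x] umb])
  have "dirderiv v (\<lambda>x. lcw_field \<phi> x \<bullet> w) x + dirderiv w (\<lambda>x. lcw_field \<phi> x \<bullet> v) x
     = 2 * (N * Hess \<phi> x v w - (g \<bullet> v) * Hess \<phi> x g w - (g \<bullet> w) * Hess \<phi> x g v) / N^2"
    unfolding dirderiv_lcw_field[OF x] g_def[symmetric] N_def[symmetric]
      Hess_commute[OF x, of w v] Hess_commute[OF x, of v g] Hess_commute[OF x, of w g]
    using N by (simp add: field_simps power2_eq_square)
  then show ?thesis
    unfolding * \<mu>_def g_def[symmetric] N4 by (simp add: field_simps)
qed

end

section \<open>Integrable conformal Killing fields\<close>

text \<open>For skew \<open>B\<close>, this is half the exterior derivative of the field \<open>(\<alpha>, c, B, \<gamma>)\<close> at \<open>y\<close>.\<close>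

definition curl_form :: "real^'n \<Rightarrow> real^'n^'n \<Rightarrow> real^'n \<Rightarrow> real^'n \<Rightarrow> real^'n \<Rightarrow> real" where
  "curl_form \<alpha> B y v w = (\<alpha> \<bullet> v) * (y \<bullet> w) - (y \<bullet> v) * (\<alpha> \<bullet> w) + w \<bullet> (B *v v)"

text \<open>Half of the 3-form \<open>X \<and> dX\<close> for \<open>X = (\<alpha>, c, B, \<gamma>)\<close>, evaluated at \<open>y\<close>.\<close>

definition frobenius_form ::
    "real^'n \<Rightarrow> real \<Rightarrow> real^'n^'n \<Rightarrow> real^'n \<Rightarrow> real^'n \<Rightarrow> real^'n \<Rightarrow> real^'n \<Rightarrow> real^'n \<Rightarrow> real" where
  "frobenius_form \<alpha> c B \<gamma> y u v w =
     (ckvf \<alpha> c B \<gamma> y \<bullet> u) * curl_form \<alpha> B y v w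
   + (ckvf \<alpha> c B \<gamma> y \<bullet> v) * curl_form \<alpha> B y w u
   + (ckvf \<alpha> c B \<gamma> y \<bullet> w) * curl_form \<alpha> B y u v"

lemma ckvf_inner:
  "ckvf \<alpha> c B \<gamma> y \<bullet> u =
     (\<alpha> \<bullet> y) * (y \<bullet> u) - 1/2 * (y \<bullet> y) * (\<alpha> \<bullet> u) + c * (y \<bullet> u) + (B *v y) \<bullet> u + \<gamma> \<bullet> u"
  unfolding ckvf_def power2_norm_eq_inner by (simp add: inner_add_left inner_diff_left)

lemma cubic_zero_coeffs:
  fixes a0 a1 a2 a3 :: real
  assumes "e > 0" "\<And>t. \<bar>t\<bar> < e \<Longrightarrow> a0 + a1 * t + a2 * t^2 + a3 * t^3 = 0"
  shows "a0 = 0 \<and> a1 = 0 \<and> a2 = 0 \<and> a3 = 0"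
proof -
  define h where "h = e / 3"
  have h: "h > 0" "\<bar>h\<bar> < e" "\<bar>-h\<bar> < e" "\<bar>2*h\<bar> < e" using assms(1) by (auto simp: h_def)
  have "a0 = 0" using assms(2)[of 0] assms(1) by simp
  moreover have "a2 * h^2 = 0"
  proof -
    have "a1 * h + a2 * h^2 + a3 * h^3 = 0" "- (a1 * h) + a2 * h^2 - a3 * h^3 = 0"
      using assms(2)[OF h(2)] assms(2)[OF h(3)] \<open>a0 = 0\<close> by simp_all
    then show ?thesis by linarith
  qed
  moreover have "a1 * h + a2 * h^2 + a3 * h^3 = 0" "2 * (a1 * h) + 4 * (a2 * h^2) + 8 * (a3 * h^3) = 0"
    using assms(2)[OF h(2)] assms(2)[OF h(4)] \<open>a0 = 0\<close>
    by (simp_all add: power_mult_distrib algebra_simps)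
  ultimately have "a0 = 0" "a2 * h^2 = 0" "a1 * h = 0" "a3 * h^3 = 0" by linarith+
  then show ?thesis using h(1) by auto
qed

context
  fixes \<alpha> \<gamma> :: "real^'n" and c :: real and B :: "real^'n^'n" and e :: real
  assumes e: "e > 0" and frob: "\<And>y u v w. norm y < e \<Longrightarrow> frobenius_form \<alpha> c B \<gamma> y u v w = 0"
begin

text \<open>The homogeneous parts, in \<open>y\<close>, of the Frobenius form: \<open>q\<close> and \<open>l\<close> are the quadratic and linear parts of
  the field, \<open>r\<close> and \<open>b\<close> the linear and constant parts of \<open>curl_form\<close>. On each ray through the origin the form is
  a cubic polynomial that vanishes near 0, so the condition on a ball implies the condition everywhere.\<close>

lemma frobenius_coeffs:
  fixes y u v w :: "real^'n"
  defines "q \<equiv> \<lambda>u. (\<alpha> \<bullet> y) * (y \<bullet> u) - 1/2 * (y \<bullet> y) * (\<alpha> \<bullet> u)"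
    and "l \<equiv> \<lambda>u. c * (y \<bullet> u) + (B *v y) \<bullet> u"
    and "r \<equiv> \<lambda>v w. (\<alpha> \<bullet> v) * (y \<bullet> w) - (y \<bullet> v) * (\<alpha> \<bullet> w)"
    and "b \<equiv> \<lambda>v w. w \<bullet> (B *v v)"
  shows "(\<gamma> \<bullet> u) * b v w + (\<gamma> \<bullet> v) * b w u + (\<gamma> \<bullet> w) * b u v = 0" (is ?A)
    and "l u * b v w + l v * b w u + l w * b u v
       + (\<gamma> \<bullet> u) * r v w + (\<gamma> \<bullet> v) * r w u + (\<gamma> \<bullet> w) * r u v = 0" (is ?B)
    and "q u * b v w + q v * b w u + q w * b u v + l u * r v w + l v * r w u + l w * r u v = 0" (is ?C)
    and "frobenius_form \<alpha> c B \<gamma> y u v w = 0" (is ?D)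
proof -
  define a0 where "a0 = (\<gamma> \<bullet> u) * b v w + (\<gamma> \<bullet> v) * b w u + (\<gamma> \<bullet> w) * b u v"
  define a1 where "a1 = l u * b v w + l v * b w u + l w * b u v
       + (\<gamma> \<bullet> u) * r v w + (\<gamma> \<bullet> v) * r w u + (\<gamma> \<bullet> w) * r u v"
  define a2 where "a2 = q u * b v w + q v * b w u + q w * b u v + l u * r v w + l v * r w u + l w * r u v"
  define a3 where "a3 = q u * r v w + q v * r w u + q w * r u v"
  have X: "ckvf \<alpha> c B \<gamma> (t *\<^sub>R y) \<bullet> u = t^2 * q u + t * l u + \<gamma> \<bullet> u" for t u
    unfolding ckvf_inner q_def l_def
    by (simp add: matrix_vector_mult_scaleR power2_eq_square algebra_simps)
  have K: "curl_form \<alpha> B (t *\<^sub>R y) v w = t * r v w + b v w" for t v w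
    unfolding curl_form_def r_def b_def by (simp add: algebra_simps)
  have expand: "frobenius_form \<alpha> c B \<gamma> (t *\<^sub>R y) u v w = a0 + a1 * t + a2 * t^2 + a3 * t^3" for t
    unfolding frobenius_form_def X K a0_def a1_def a2_def a3_def
    by (simp add: algebra_simps power2_eq_square power3_eq_cube)
  have "a0 = 0 \<and> a1 = 0 \<and> a2 = 0 \<and> a3 = 0"
  proof (rule cubic_zero_coeffs)
    show "e / (norm y + 1) > 0" using e by (simp add: add_nonneg_pos)
    fix t assume t: "\<bar>t\<bar> < e / (norm y + 1)"
    have "norm y + 1 > 0" by (simp add: add_nonneg_pos)
    then have "\<bar>t\<bar> * norm y + \<bar>t\<bar> < e" using t by (simp add: pos_less_divide_eq algebra_simps)
    then have "norm (t *\<^sub>R y) < e" by simp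
    then show "a0 + a1 * t + a2 * t^2 + a3 * t^3 = 0" using frob expand[of t] by metis
  qed
  moreover then have "frobenius_form \<alpha> c B \<gamma> (1 *\<^sub>R y) u v w = 0" unfolding expand by simp
  ultimately show ?A ?B ?C ?D unfolding a0_def a1_def a2_def by simp_all
qed

end

lemma common_perp:
  fixes a b :: "real^'n"
  assumes "CARD('n) \<ge> 3"
  shows "\<exists>y. y \<noteq> 0 \<and> y \<bullet> a = 0 \<and> y \<bullet> b = 0"
proof -
  have "dim {a, b} \<le> card {a, b}" by (rule dim_le_card') simp
  also have "\<dots> \<le> 2" by (simp add: card_insert_if)
  finally have "dim {a, b} < DIM(real^'n)" using assms by simp
  then obtain y where "y \<noteq> 0" "\<And>z. z \<in> span {a, b} \<Longrightarrow> orthogonal y z"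
    using orthogonal_to_subspace_exists by metis
  then show ?thesis by (metis insertCI orthogonal_def span_base)
qed

lemma unit_perp:
  fixes a :: "real^'n"
  assumes "CARD('n) \<ge> 3"
  shows "\<exists>\<sigma>. norm \<sigma> = 1 \<and> a \<bullet> \<sigma> = 0"
proof -
  obtain y where "y \<noteq> 0" "y \<bullet> a = 0" using common_perp[OF assms] by metis
  then have "norm (y /\<^sub>R norm y) = 1" "a \<bullet> (y /\<^sub>R norm y) = 0" by (simp_all add: inner_commute)
  then show ?thesis by blast
qed

lemma wedge_vector_mult: "wedge a b *v v = (b \<bullet> v) *\<^sub>R a - (a \<bullet> v) *\<^sub>R b"
  by (simp add: vec_eq_iff wedge_def matrix_vector_mult_def inner_vec_def
      left_diff_distrib right_diff_distrib sum_subtractf sum_distrib_left sum_distrib_right mult.assoc mult.commute mult.left_commute)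

text \<open>A translation moves \<open>c\<close> along \<open>\<alpha>\<close> and \<open>B\<close> by matrices of the form \<open>h \<and> \<alpha>\<close>; this is what allows them to
  be removed when \<open>\<alpha> \<noteq> 0\<close>.\<close>

lemma ckvf_translate:
  "ckvf \<alpha> c B \<gamma> (y + h) = ckvf \<alpha> (c + \<alpha> \<bullet> h) (B + wedge h \<alpha>) (ckvf \<alpha> c B \<gamma> h) y"
proof (rule vector_eq_rdot[THEN iffD1], intro allI)
  fix u
  show "ckvf \<alpha> c B \<gamma> (y + h) \<bullet> u = ckvf \<alpha> (c + \<alpha> \<bullet> h) (B + wedge h \<alpha>) (ckvf \<alpha> c B \<gamma> h) y \<bullet> u"
    unfolding ckvf_inner matrix_vector_mult_add_rdistrib matrix_vector_right_distrib wedge_vector_mult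
      inner_add_left inner_add_right inner_diff_left inner_scaleR_left inner_commute[of h y]
    by algebra
qed

lemma curl_form_translate:
  "curl_form \<alpha> B (y + h) v w = curl_form \<alpha> (B + wedge h \<alpha>) y v w"
  unfolding curl_form_def matrix_vector_mult_add_rdistrib wedge_vector_mult
    inner_add_left inner_add_right inner_diff_right inner_scaleR_right
    inner_commute[of w h] inner_commute[of w \<alpha>]
  by algebra

text \<open>The images \<open>p = B a\<close> and \<open>q = B p\<close> turn out to span the image of \<open>B\<close>; they are orthogonal since \<open>B\<close> is skew,
  so normalising them gives the plane of rotation.\<close>

lemma frobenius_affine_case:
  fixes B :: "real^'n^'n"
  assumes n3: "CARD('n) \<ge> 3"
    and skew: "\<And>u v. u \<bullet> (B *v v) = - (v \<bullet> (B *v u))"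
    and frob: "\<And>y u v w. frobenius_form 0 c B \<gamma> y u v w = 0"
    and B: "B \<noteq> 0"
  shows "\<exists>\<beta> a b h. \<beta> \<noteq> 0 \<and> norm a = 1 \<and> norm b = 1 \<and> a \<bullet> b = 0 \<and>
           (\<forall>y. ckvf 0 c B \<gamma> y = \<beta> *\<^sub>R ckvf 0 0 (wedge a b) 0 (y - h))"
proof -
  note coeffs = frobenius_coeffs[OF zero_less_one frob]
  have sk0: "u \<bullet> (B *v u) = 0" for u using skew[of u u] by simp
  obtain a where a: "B *v a \<noteq> 0" using B by (metis matrix_eq matrix_vector_mult_0)
  define p where "p = B *v a"
  have pp: "p \<bullet> p > 0" using a by (simp add: p_def)
  have c: "c = 0"
  proof -
    obtain y where y: "y \<noteq> 0" "y \<bullet> a = 0" "y \<bullet> p = 0" using common_perp[OF n3] by metis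
    \<comment> \<open>A vector orthogonal to the plane of \<open>a\<close> and \<open>B a\<close> detects the dilation part.\<close>
    have "c * ((y \<bullet> y) * (p \<bullet> p)) = 0"
      using coeffs(2)[of y y a p] y sk0[of y] skew[of y p] skew[of a y] skew[of a p]
      by (simp add: p_def[symmetric] inner_commute)
    then show ?thesis using y pp by simp
  qed
  define q where "q = B *v p"
  have pq: "p \<bullet> q = 0" unfolding q_def by (rule sk0)
  have Bv: "(p \<bullet> p) *\<^sub>R (B *v v) = (p \<bullet> v) *\<^sub>R q - (q \<bullet> v) *\<^sub>R p" for v
  proof (rule vector_eq_ldot[THEN iffD1], intro allI)
    fix w
    show "w \<bullet> (p \<bullet> p) *\<^sub>R (B *v v) = w \<bullet> ((p \<bullet> v) *\<^sub>R q - (q \<bullet> v) *\<^sub>R p)"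
      using coeffs(2)[of a p v w] skew[of p w] skew[of p v] skew[of v w]
      by (simp add: c p_def[symmetric] q_def[symmetric] inner_diff_right inner_commute algebra_simps)
  qed
  have q0: "q \<noteq> 0"
    using Bv[of a] pp a pq by (auto simp: p_def[symmetric])
  define \<beta> where "\<beta> = norm q / norm p"
  define a' where "a' = q /\<^sub>R norm q"
  define b' where "b' = p /\<^sub>R norm p"
  have p0: "p \<noteq> 0" using pp by auto
  have u: "norm a' = 1" "norm b' = 1" "a' \<bullet> b' = 0"
    using q0 p0 pq by (simp_all add: a'_def b'_def inner_commute)
  have ab: "a' \<bullet> a' = 1" "b' \<bullet> b' = 1" "b' \<bullet> a' = 0"
    using u by (simp_all add: norm_eq_1 inner_commute)
  have Bw: "B *v v = \<beta> *\<^sub>R (wedge a' b' *v v)" for v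
  proof -
    have "B *v v = (1 / (p \<bullet> p)) *\<^sub>R ((p \<bullet> v) *\<^sub>R q - (q \<bullet> v) *\<^sub>R p)"
      using Bv[of v] pp by (metis scaleR_scaleR scaleR_one nonzero_divide_eq_eq less_irrefl mult.commute mult.right_neutral times_divide_eq_left mult_1)
    also have "p \<bullet> p = norm p * norm p" by (simp add: dot_square_norm power2_eq_square)
    finally show ?thesis
      using q0 p0 by (simp add: wedge_vector_mult \<beta>_def a'_def b'_def scaleR_diff_right field_simps)
  qed
  have \<beta>: "\<beta> \<noteq> 0" using p0 q0 by (simp add: \<beta>_def)
  have \<gamma>: "\<gamma> = (\<gamma> \<bullet> b') *\<^sub>R b' + (\<gamma> \<bullet> a') *\<^sub>R a'"
  proof (rule vector_eq_rdot[THEN iffD1], intro allI)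
    fix u
    have "\<beta> * (\<gamma> \<bullet> u) = \<beta> * (((\<gamma> \<bullet> b') *\<^sub>R b' + (\<gamma> \<bullet> a') *\<^sub>R a') \<bullet> u)"
      using coeffs(1)[of u b' a']
      by (simp add: Bw wedge_vector_mult ab u(3) inner_simps inner_commute algebra_simps)
    then show "\<gamma> \<bullet> u = ((\<gamma> \<bullet> b') *\<^sub>R b' + (\<gamma> \<bullet> a') *\<^sub>R a') \<bullet> u" using \<beta> by simp
  qed
  \<comment> \<open>The centre \<open>h\<close> is the zero of the field in the plane of rotation: it solves \<open>B h = - \<gamma>\<close>.\<close>
  define h where "h = (1 / \<beta>) *\<^sub>R ((\<gamma> \<bullet> b') *\<^sub>R a' - (\<gamma> \<bullet> a') *\<^sub>R b')"
  have "b' \<bullet> h = (\<gamma> \<bullet> a') * (- 1 / \<beta>)" "a' \<bullet> h = (\<gamma> \<bullet> b') / \<beta>"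
    by (simp_all add: h_def ab u(3) inner_diff_right)
  then have "B *v h = - ((\<gamma> \<bullet> b') *\<^sub>R b' + (\<gamma> \<bullet> a') *\<^sub>R a')"
    unfolding Bw wedge_vector_mult using \<beta> by (simp add: scaleR_diff_right)
  then have "B *v h = - \<gamma>" using \<gamma> by metis
  then have "ckvf 0 c B \<gamma> y = \<beta> *\<^sub>R ckvf 0 0 (wedge a' b') 0 (y - h)" for y
    unfolding ckvf_def c by (simp add: Bw[symmetric] matrix_vector_mult_diff_distrib scaleR_diff_right)
  then show ?thesis using \<beta> u by blast
qed

text \<open>The quadratic coefficient kills the restriction of the bilinear form of \<open>B\<close> to the complement of \<open>\<alpha>\<close>, so \<open>B = z \<and> \<alpha>\<close> and a
  translation reduces the field to \<open>(\<alpha>, 0, 0, g)\<close>. The linear coefficient, tested on \<open>\<alpha>\<close>, the component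
  \<open>g'\<close> of \<open>g\<close> orthogonal to \<open>\<alpha>\<close>, and a vector orthogonal to both, gives \<open>g' = 0\<close>.\<close>

lemma frobenius_quadratic_case:
  fixes B :: "real^'n^'n"
  assumes n3: "CARD('n) \<ge> 3"
    and skew: "\<And>u v. u \<bullet> (B *v v) = - (v \<bullet> (B *v u))"
    and frob: "\<And>y u v w. frobenius_form \<alpha> c B \<gamma> y u v w = 0"
    and \<alpha>: "\<alpha> \<noteq> 0"
  shows "\<exists>k h. \<forall>y. ckvf \<alpha> c B \<gamma> y = ckvf \<alpha> 0 0 (k *\<^sub>R \<alpha>) (y - h)"
proof -
  have aa: "\<alpha> \<bullet> \<alpha> > 0" using \<alpha> by simp
  have sk0: "u \<bullet> (B *v u) = 0" for u using skew[of u u] by simp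
  have perp: "v \<bullet> (B *v y) = 0" if y: "y \<bullet> \<alpha> = 0" and v: "v \<bullet> \<alpha> = 0" for v y
  proof -
    have "(y \<bullet> y) * (\<alpha> \<bullet> \<alpha>) * (v \<bullet> (B *v y)) = 0"
    proof -
      have "\<alpha> \<bullet> y = 0" "\<alpha> \<bullet> v = 0" "(B *v y) \<bullet> y = 0" "(B *v y) \<bullet> v = v \<bullet> (B *v y)"
        using y v sk0[of y] by (simp_all add: inner_commute)
      then show ?thesis
        using frobenius_coeffs(3)[OF zero_less_one frob, of y \<alpha> v y] y v
        by (simp add: skew[of y v]) (auto simp: algebra_simps)
    qed
    then show ?thesis using aa by (cases "y = 0") auto
  qed
  define z where "z = (1 / (\<alpha> \<bullet> \<alpha>)) *\<^sub>R (B *v \<alpha>)"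
  have Ba: "B *v \<alpha> = (\<alpha> \<bullet> \<alpha>) *\<^sub>R z" using aa by (simp add: z_def)
  have za: "z \<bullet> \<alpha> = 0" "\<alpha> \<bullet> z = 0" using sk0[of \<alpha>] by (simp_all add: z_def inner_commute)
  have B: "B = wedge z \<alpha>"
    unfolding matrix_eq
  proof
    fix y
    define t where "t = (\<alpha> \<bullet> y) / (\<alpha> \<bullet> \<alpha>)"
    define y' where "y' = y - t *\<^sub>R \<alpha>"
    have y': "y' \<bullet> \<alpha> = 0" using aa by (simp add: y'_def t_def inner_diff_left inner_commute[of y \<alpha>])
    have "w \<bullet> (B *v y) = w \<bullet> (wedge z \<alpha> *v y)" for w
    proof -
      define s where "s = (\<alpha> \<bullet> w) / (\<alpha> \<bullet> \<alpha>)"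
      define w' where "w' = w - s *\<^sub>R \<alpha>"
      have w': "w' \<bullet> \<alpha> = 0" using aa by (simp add: w'_def s_def inner_diff_left inner_commute[of w \<alpha>])
      have y: "y = y' + t *\<^sub>R \<alpha>" and w: "w = w' + s *\<^sub>R \<alpha>" by (simp_all add: y'_def w'_def)
      have "\<alpha> \<bullet> (B *v y') = - ((\<alpha> \<bullet> \<alpha>) * (y' \<bullet> z))"
        using skew[of \<alpha> y'] by (simp add: Ba)
      then show ?thesis
        unfolding y w using perp[OF y' w'] y' w' za
        by (simp add: wedge_vector_mult inner_simps matrix_vector_right_distrib matrix_vector_mult_scaleR Ba inner_commute algebra_simps)
    qed
    then show "B *v y = wedge z \<alpha> *v y" using vector_eq_ldot by blast
  qed
  \<comment> \<open>The first summand removes \<open>B\<close>; the second, parallel to \<open>\<alpha>\<close>, leaves \<open>B\<close> alone and removes \<open>c\<close>.\<close>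
  define h where "h = - z - (c / (\<alpha> \<bullet> \<alpha>)) *\<^sub>R \<alpha>"
  have ch: "c + \<alpha> \<bullet> h = 0" using aa za by (simp add: h_def inner_simps)
  have Bh: "B + wedge h \<alpha> = 0"
    unfolding matrix_eq B by (simp add: wedge_vector_mult matrix_vector_mult_add_rdistrib h_def inner_simps algebra_simps)
  define g where "g = ckvf \<alpha> c B \<gamma> h"
  have tr: "ckvf \<alpha> c B \<gamma> (y + h) = ckvf \<alpha> 0 0 g y" for y
    unfolding ckvf_translate ch Bh g_def by simp
  have frob': "frobenius_form \<alpha> 0 0 g y u v w = 0" for y u v w
    using frob[of "y + h" u v w] unfolding frobenius_form_def curl_form_translate tr Bh .
  define k where "k = (g \<bullet> \<alpha>) / (\<alpha> \<bullet> \<alpha>)"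
  define g' where "g' = g - k *\<^sub>R \<alpha>"
  have g'\<alpha>: "g' \<bullet> \<alpha> = 0" using aa by (simp add: g'_def k_def inner_diff_left)
  have gg: "g \<bullet> g' = g' \<bullet> g'"
    using g'\<alpha> by (simp add: g'_def inner_diff_left inner_diff_right inner_commute)
  obtain y where y: "y \<noteq> 0" "y \<bullet> \<alpha> = 0" "y \<bullet> g = 0" using common_perp[OF n3] by metis
  have yg': "y \<bullet> g' = 0" using y by (simp add: g'_def inner_diff_right)
  have "(g' \<bullet> g') * ((\<alpha> \<bullet> \<alpha>) * (y \<bullet> y)) = 0"
    using frobenius_coeffs(2)[OF zero_less_one frob', of y g' \<alpha> y] y yg' g'\<alpha> gg
    by (simp add: inner_commute)
  then have "g' = 0" using aa y by simp
  then have "g = k *\<^sub>R \<alpha>" by (simp add: g'_def)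
  then have "ckvf \<alpha> c B \<gamma> y = ckvf \<alpha> 0 0 (k *\<^sub>R \<alpha>) (y - h)" for y
    using tr[of "y - h"] by simp
  then show ?thesis by blast
qed

definition model_field :: "real^'n \<Rightarrow> real^'n \<Rightarrow> real \<Rightarrow> (real^'n \<Rightarrow> real^'n) \<Rightarrow> bool" where
  "model_field \<gamma> \<sigma> s X \<longleftrightarrow> X = ckvf 0 0 0 \<gamma> \<or> X = ckvf 0 1 0 0 \<or> X = ckvf 0 0 (wedge \<gamma> \<sigma>) 0
     \<or> X = ckvf \<gamma> 0 0 0 \<or> X = ckvf \<gamma> 0 0 ((s/2) *\<^sub>R \<gamma>) \<or> X = ckvf \<gamma> 0 0 (- (s/2) *\<^sub>R \<gamma>)"

lemma integrable_ckvf_normal_form: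
  fixes B :: "real^'n^'n"
  assumes n3: "CARD('n) \<ge> 3"
    and skew: "\<And>u v. u \<bullet> (B *v v) = - (v \<bullet> (B *v u))"
    and e: "e > 0" and frob: "\<And>y u v w. norm y < e \<Longrightarrow> frobenius_form \<alpha> c B \<gamma> y u v w = 0"
    and nz: "ckvf \<alpha> c B \<gamma> y0 \<noteq> 0"
  shows "\<exists>m h a b s X. m \<noteq> 0 \<and> norm a = 1 \<and> norm b = 1 \<and> a \<bullet> b = 0 \<and> s > 0 \<and> model_field a b s X \<and>
           (\<forall>y. ckvf \<alpha> c B \<gamma> y = m *\<^sub>R X (y - h))"
proof -
  note frob' = frobenius_coeffs(4)[OF e frob]
  obtain e1 :: "real^'n" where e1: "norm e1 = 1" using unit_perp[OF n3] by metis
  \<comment> \<open>A model involves only some of \<open>a\<close>, \<open>b\<close> and \<open>s\<close>; the others receive arbitrary admissible values.\<close>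
  have fin: ?thesis if "m \<noteq> 0" "norm a = 1" "s > 0" "\<And>b. model_field a b s X" "\<And>y. ckvf \<alpha> c B \<gamma> y = m *\<^sub>R X (y - h)"
    for m h s X and a :: "real^'n"
    using that unit_perp[OF n3, of a] by metis
  consider "\<alpha> \<noteq> 0" | "\<alpha> = 0" "B \<noteq> 0" | "\<alpha> = 0" "B = 0" "c \<noteq> 0" | "\<alpha> = 0" "B = 0" "c = 0" by blast
  then show ?thesis
  proof cases
    case 1
    obtain k h where kh: "\<And>y. ckvf \<alpha> c B \<gamma> y = ckvf \<alpha> 0 0 (k *\<^sub>R \<alpha>) (y - h)"
      using frobenius_quadratic_case[OF n3 skew frob' 1] by blast
    define a where "a = \<alpha> /\<^sub>R norm \<alpha>"
    have a: "norm a = 1" "\<alpha> = norm \<alpha> *\<^sub>R a" using 1 by (simp_all add: a_def)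
    have X: "ckvf \<alpha> c B \<gamma> y = norm \<alpha> *\<^sub>R ckvf a 0 0 (k *\<^sub>R a) (y - h)" for y
      unfolding kh by (subst a(2), subst (2) a(2)) (simp add: ckvf_def scaleR_add_right scaleR_diff_right inner_scaleR_left mult.commute mult.left_commute)
    consider "k > 0" | "k = 0" | "k < 0" by linarith
    then show ?thesis
    proof cases
      case 1
      then show ?thesis
        by (intro fin[OF _ a(1) _ _ X, of "2 * k"]) (use \<open>\<alpha> \<noteq> 0\<close> in \<open>auto simp: model_field_def\<close>)
    next
      case 2
      then show ?thesis
        by (intro fin[OF _ a(1) _ _ X, of 1]) (use \<open>\<alpha> \<noteq> 0\<close> in \<open>auto simp: model_field_def\<close>)
    next
      case 3
      then show ?thesis
        by (intro fin[OF _ a(1) _ _ X, of "- 2 * k"]) (use \<open>\<alpha> \<noteq> 0\<close> in \<open>auto simp: model_field_def\<close>)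
    qed
  next
    case 2
    then obtain \<beta> a b h where "\<beta> \<noteq> 0" "norm a = 1" "norm b = 1" "a \<bullet> b = 0"
      "\<forall>y. ckvf \<alpha> c B \<gamma> y = \<beta> *\<^sub>R ckvf 0 0 (wedge a b) 0 (y - h)"
      using frobenius_affine_case[OF n3 skew, of c \<gamma>] frob' by metis
    moreover have "model_field a b 1 (ckvf 0 0 (wedge a b) 0)" by (simp add: model_field_def)
    ultimately show ?thesis using zero_less_one by blast
  next
    case 3
    have "ckvf \<alpha> c B \<gamma> y = c *\<^sub>R ckvf 0 1 0 0 (y - (- (1 / c) *\<^sub>R \<gamma>))" for y
      using 3 by (simp add: ckvf_def scaleR_add_right)
    then show ?thesis
      using 3 e1 by (intro fin[where m = c and h = "- (1 / c) *\<^sub>R \<gamma>" and a = e1 and s = 1 and X = "ckvf 0 1 0 0"]) (auto simp: model_field_def)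
  next
    case 4
    then have "\<gamma> \<noteq> 0" using nz by (simp add: ckvf_def)
    moreover from this have "ckvf \<alpha> c B \<gamma> y = norm \<gamma> *\<^sub>R ckvf 0 0 0 (\<gamma> /\<^sub>R norm \<gamma>) (y - 0)" for y
      using 4 by (simp add: ckvf_def)
    ultimately show ?thesis
      by (intro fin[where m = "norm \<gamma>" and h = 0 and a = "\<gamma> /\<^sub>R norm \<gamma>" and s = 1 and X = "ckvf 0 0 0 (\<gamma> /\<^sub>R norm \<gamma>)"]) (auto simp: model_field_def)
  qed
qed

section \<open>Potentials of the normal forms\<close>

text \<open>The relation \<open>X = |\<nabla>\<psi>|\<^sup>-\<^sup>2 \<nabla>\<psi>\<close>, solved for \<open>\<nabla>\<psi> = X / |X|\<^sup>2\<close>. In this form two potentials of the same field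
  have the same derivative, and rescaling \<open>\<psi>\<close> by \<open>m\<close> divides \<open>X\<close> by \<open>m\<close>.\<close>

definition potential :: "(real^'n) set \<Rightarrow> (real^'n \<Rightarrow> real) \<Rightarrow> (real^'n \<Rightarrow> real^'n) \<Rightarrow> bool" where
  "potential D \<psi> X \<longleftrightarrow>
     (\<forall>y\<in>D. X y \<noteq> 0 \<and> (\<psi> has_derivative (\<lambda>v. (X y \<bullet> v) / (X y \<bullet> X y))) (at y))"

lemma potential_grad:
  assumes "potential D \<psi> X" "y \<in> D"
  shows "\<psi> differentiable (at y)" "grad \<psi> y \<noteq> 0" "X y = (1 / (norm (grad \<psi> y))^2) *\<^sub>R grad \<psi> y"
proof -
  have X: "X y \<noteq> 0" and d: "(\<psi> has_derivative (\<lambda>v. (X y \<bullet> v) / (X y \<bullet> X y))) (at y)"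
    using assms by (auto simp: potential_def)
  show diff: "\<psi> differentiable (at y)" using differentiableI[OF d] .
  have g: "grad \<psi> y = (1 / (X y \<bullet> X y)) *\<^sub>R X y"
    using dirderiv_eq_grad[OF diff] dirderiv_eqI[OF d] by (intro vector_eq_rdot[THEN iffD1]) simp
  then show "grad \<psi> y \<noteq> 0" using X by simp
  show "X y = (1 / (norm (grad \<psi> y))^2) *\<^sub>R grad \<psi> y"
    unfolding g power2_norm_eq_inner using X by simp
qed

lemma potential_linear: "norm \<gamma> = 1 \<Longrightarrow> potential UNIV (\<lambda>x. \<gamma> \<bullet> x) (ckvf 0 0 0 \<gamma>)"
  by (auto simp: potential_def ckvf_def norm_eq_1 intro!: derivative_eq_intros)

lemma potential_ln_norm: "potential (- {0}) (\<lambda>x. ln (norm x)) (ckvf 0 1 0 0)"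
  unfolding potential_def
proof
  fix y :: "real^'n" assume "y \<in> - {0}"
  then have y: "y \<bullet> y > 0" by simp
  have "((\<lambda>x. x \<bullet> x) has_derivative (\<lambda>v. 2 * (y \<bullet> v))) (at y)"
    by (auto intro!: derivative_eq_intros simp: inner_commute)
  note has_derivative_mult_left[OF DERIV_compose_FDERIV[OF DERIV_ln_divide[OF y] this], of "1/2"]
  then have "((\<lambda>x. ln (x \<bullet> x) / 2) has_derivative (\<lambda>v. (y \<bullet> v) / (y \<bullet> y))) (at y)"
    by simp
  then show "ckvf 0 1 0 0 y \<noteq> 0 \<and> ((\<lambda>x. ln (norm x)) has_derivative (\<lambda>v. (ckvf 0 1 0 0 y \<bullet> v) / (ckvf 0 1 0 0 y \<bullet> ckvf 0 1 0 0 y))) (at y)"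
    using y by (auto simp: ckvf_def norm_eq_sqrt_inner ln_sqrt)
qed

lemma ckvf_parallel:
  "ckvf \<gamma> 0 0 (k *\<^sub>R \<gamma>) y = (\<gamma> \<bullet> y) *\<^sub>R y + (k - (y \<bullet> y) / 2) *\<^sub>R \<gamma>"
  by (simp add: ckvf_def power2_norm_eq_inner scaleR_diff_left)

lemma ckvf_parallel_norm:
  assumes "norm \<gamma> = 1"
  shows "ckvf \<gamma> 0 0 (k *\<^sub>R \<gamma>) y \<bullet> ckvf \<gamma> 0 0 (k *\<^sub>R \<gamma>) y = 2 * k * (\<gamma> \<bullet> y)^2 + (k - (y \<bullet> y) / 2)^2"
proof -
  have "\<gamma> \<bullet> \<gamma> = 1" using assms by (simp add: norm_eq_1)
  then show ?thesis
    unfolding ckvf_parallel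
    by (simp add: inner_add_left inner_add_right inner_commute[of y \<gamma>] power2_eq_square) (simp add: algebra_simps)
qed

lemma potential_inversion:
  fixes \<gamma> :: "real^'n"
  assumes "norm \<gamma> = 1"
  shows "potential (- {0}) (\<lambda>x. - 2 * ((\<gamma> \<bullet> x) / (norm x)^2)) (ckvf \<gamma> 0 0 0)"
  unfolding potential_def
proof
  fix y :: "real^'n" assume "y \<in> - {0}"
  then have y: "y \<bullet> y > 0" by simp
  have N: "ckvf \<gamma> 0 0 0 y \<bullet> ckvf \<gamma> 0 0 0 y = (y \<bullet> y)^2 / 4"
    using ckvf_parallel_norm[OF assms, of 0 y] by (simp add: power2_eq_square)
  have X: "ckvf \<gamma> 0 0 0 y \<bullet> v = (\<gamma> \<bullet> y) * (y \<bullet> v) - (y \<bullet> y) / 2 * (\<gamma> \<bullet> v)" for v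
    by (simp add: ckvf_inner)
  have "ckvf \<gamma> 0 0 0 y \<noteq> 0" using N y by auto
  moreover have "((\<lambda>x. - 2 * ((\<gamma> \<bullet> x) / (norm x)^2)) has_derivative (\<lambda>v. (ckvf \<gamma> 0 0 0 y \<bullet> v) / (ckvf \<gamma> 0 0 0 y \<bullet> ckvf \<gamma> 0 0 0 y))) (at y)"
  proof -
    have n: "((\<lambda>x. - 2 * (\<gamma> \<bullet> x)) has_derivative (\<lambda>v. - 2 * (\<gamma> \<bullet> v))) (at y)"
      by (auto intro!: derivative_eq_intros)
    have d: "((\<lambda>x. x \<bullet> x) has_derivative (\<lambda>v. 2 * (y \<bullet> v))) (at y)"
      by (auto intro!: derivative_eq_intros simp: inner_commute)
    have "(- 2 * (\<gamma> \<bullet> v) * (y \<bullet> y) - - 2 * (\<gamma> \<bullet> y) * (2 * (y \<bullet> v))) / ((y \<bullet> y) * (y \<bullet> y))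
        = (ckvf \<gamma> 0 0 0 y \<bullet> v) / (ckvf \<gamma> 0 0 0 y \<bullet> ckvf \<gamma> 0 0 0 y)" for v
      unfolding N unfolding X using y by (simp add: divide_simps power2_eq_square)
    then show ?thesis
      using has_derivative_divide'[OF n d] y by (simp add: power2_norm_eq_inner)
  qed
  ultimately show "ckvf \<gamma> 0 0 0 y \<noteq> 0 \<and> ((\<lambda>x. - 2 * ((\<gamma> \<bullet> x) / (norm x)^2)) has_derivative (\<lambda>v. (ckvf \<gamma> 0 0 0 y \<bullet> v) / (ckvf \<gamma> 0 0 0 y \<bullet> ckvf \<gamma> 0 0 0 y))) (at y)" ..
qed

text \<open>Both claims rest on \<open>1 - w\<^sup>2 = 4 |X|\<^sup>2 / (s\<^sup>2 A\<^sup>2)\<close>, where \<open>A\<close> is the denominator of \<open>w\<close>: the argument of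
  \<open>artanh\<close> leaves its domain exactly at the two zeros of \<open>X\<close>.\<close>

lemma
  fixes \<gamma> :: "real^'n"
  assumes \<gamma>: "norm \<gamma> = 1" and s: "s > 0"
  defines "w \<equiv> \<lambda>x. (- 2 * (\<gamma> \<bullet> x) / sqrt s) / ((norm x)^2 / s + 1)"
    and "X \<equiv> ckvf \<gamma> 0 0 (- (s/2) *\<^sub>R \<gamma>)"
  shows artanh_domain: "\<bar>w y\<bar> < 1 \<longleftrightarrow> X y \<noteq> 0"
    and potential_artanh: "potential {x. \<bar>w x\<bar> < 1} (\<lambda>x. 1 / sqrt s * artanh (w x)) X"
proof -
  define A where "A x = (x \<bullet> x) / s + 1" for x :: "real^'n"
  have A: "A x > 0" for x using s by (simp add: A_def add_nonneg_pos)
  have ss: "sqrt s * sqrt s = s" "sqrt s > 0" using s by simp_all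
  have w: "w x = (- 2 * (\<gamma> \<bullet> x) / sqrt s) / A x" for x
    unfolding w_def A_def power2_norm_eq_inner ..
  have XX: "X y \<bullet> X y = s^2 / 4 * ((A y)^2 - 4 * (\<gamma> \<bullet> y)^2 / s)" for y
    unfolding X_def ckvf_parallel_norm[OF \<gamma>] A_def using s by (simp add: field_simps power2_eq_square)
  have w2: "(w y)^2 = 4 * (\<gamma> \<bullet> y)^2 / s / (A y)^2" for y
    unfolding w using s by (simp add: power_divide power_mult_distrib)
  have 1: "1 - (w y)^2 = 4 / s^2 * (X y \<bullet> X y) / (A y)^2" for y
    unfolding XX w2 using s A[of y] by (simp add: field_simps)
  show dom: "\<bar>w y\<bar> < 1 \<longleftrightarrow> X y \<noteq> 0" for y
  proof -
    have "\<bar>w y\<bar> < 1 \<longleftrightarrow> 0 < 1 - (w y)^2" by (simp add: abs_square_less_1)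
    also have "\<dots> \<longleftrightarrow> X y \<noteq> 0"
      unfolding 1 using s A[of y] by (simp add: zero_less_divide_iff zero_less_mult_iff)
    finally show ?thesis .
  qed
  have "((\<lambda>x. 1 / sqrt s * artanh (w x)) has_derivative (\<lambda>v. (X y \<bullet> v) / (X y \<bullet> X y))) (at y)" if y: "\<bar>w y\<bar> < 1" for y
  proof -
    have Xy: "X y \<bullet> X y > 0" using dom y by simp
    have dw: "(w has_derivative (\<lambda>v. ((- 2 * (\<gamma> \<bullet> v) / sqrt s) * A y - (- 2 * (\<gamma> \<bullet> y) / sqrt s) * (2 * (y \<bullet> v) / s)) / (A y)^2)) (at y)"
    proof -
      have n: "((\<lambda>x. - 2 * (\<gamma> \<bullet> x) / sqrt s) has_derivative (\<lambda>v. - 2 * (\<gamma> \<bullet> v) / sqrt s)) (at y)"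
        using s by (auto intro!: derivative_eq_intros simp: fun_eq_iff field_simps)
      have dA: "(A has_derivative (\<lambda>v. 2 * (y \<bullet> v) / s)) (at y)"
        unfolding A_def[abs_def] using s by (auto intro!: derivative_eq_intros simp: inner_commute)
      show ?thesis
        unfolding w[abs_def] power2_eq_square
        using has_derivative_divide'[OF n dA] A[of y] by simp
    qed
    have d: "((\<lambda>x. artanh (w x)) has_derivative (\<lambda>v. ((- 2 * (\<gamma> \<bullet> v) / sqrt s) * A y - (- 2 * (\<gamma> \<bullet> y) / sqrt s) * (2 * (y \<bullet> v) / s)) / (A y)^2 * (1 / (1 - (w y)^2)))) (at y)"
      by (rule DERIV_compose_FDERIV[OF artanh_real_has_field_derivative[OF y] dw])
    have e: "1 / sqrt s * (((- 2 * (\<gamma> \<bullet> v) / sqrt s) * A y - (- 2 * (\<gamma> \<bullet> y) / sqrt s) * (2 * (y \<bullet> v) / s)) / (A y)^2 * (1 / (1 - (w y)^2)))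
      = (X y \<bullet> v) / (X y \<bullet> X y)" for v
    proof -
      \<comment> \<open>The identity with \<open>q\<close> for the square root of \<open>s\<close>, so that it is rational in all variables.\<close>
      have alg: "1 / q * (((- 2 * G / q) * a - (- 2 * T / q) * (2 * P / (q * q))) / a^2 * (1 / (4 / (q * q)^2 * Z / a^2)))
          = (T * P - (q * q) / 2 * a * G) / Z" if "q > 0" "a > 0" "Z > 0" for q a Z G T P :: real
        using that by (simp add: field_simps power2_eq_square)
      have "X y \<bullet> v = (\<gamma> \<bullet> y) * (y \<bullet> v) - s / 2 * A y * (\<gamma> \<bullet> v)"
        using s by (simp add: X_def A_def ckvf_inner field_simps)
      then show ?thesis
        unfolding 1 using alg[OF ss(2) A[of y] Xy, unfolded ss(1)] by simp
    qed
    show ?thesis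
      using has_derivative_mult_right[OF d, of "1 / sqrt s"] unfolding e .
  qed
  then show "potential {x. \<bar>w x\<bar> < 1} (\<lambda>x. 1 / sqrt s * artanh (w x)) X"
    unfolding potential_def using dom by simp
qed

section \<open>Branches of the angle\<close>

text \<open>The hypothesis \<open>ang\<close> says that \<open>\<theta>\<close> has the derivative of the argument of \<open>v + i u\<close>. Hence the real part
  \<open>W\<close> of \<open>(v + i u) exp (- i \<theta>)\<close> has the same logarithmic derivative \<open>\<rho>\<close> as the modulus \<open>r\<close>, so \<open>W / r\<close> is
  constant. It is 1 at \<open>p\<close>; where the real part equals the modulus, the imaginary part \<open>W2\<close> vanishes.\<close>

lemma arctan_branchI:
  fixes u v \<theta> :: "real^'n \<Rightarrow> real"
  assumes D: "open D" "connected D" "p \<in> D" and sm: "smooth_on D \<theta>"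
    and u: "\<And>x. x \<in> D \<Longrightarrow> (u has_derivative u' x) (at x)"
    and v: "\<And>x. x \<in> D \<Longrightarrow> (v has_derivative v' x) (at x)"
    and \<theta>: "\<And>x. x \<in> D \<Longrightarrow> (\<theta> has_derivative \<theta>' x) (at x)"
    and ang: "\<And>x h. x \<in> D \<Longrightarrow> ((u x)^2 + (v x)^2) * \<theta>' x h = v x * u' x h - u x * v' x h"
    and nz: "\<And>x. x \<in> D \<Longrightarrow> \<not> (u x = 0 \<and> v x = 0)"
    and p: "v p = sqrt ((u p)^2 + (v p)^2) * cos (\<theta> p)" "u p = sqrt ((u p)^2 + (v p)^2) * sin (\<theta> p)"
  shows "arctan_branch D u v \<theta>"
proof -
  define r where "r x = sqrt ((u x)^2 + (v x)^2)" for x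
  define W where "W x = v x * cos (\<theta> x) + u x * sin (\<theta> x)" for x
  have r2: "(r x)^2 = (u x)^2 + (v x)^2" for x by (simp add: r_def)
  have r0: "r x > 0" if "x \<in> D" for x
    using nz[OF that] by (auto simp: r_def sum_power2_gt_zero_iff)
  have der: "((\<lambda>x. W x / r x) has_derivative (\<lambda>h. 0)) (at x)" if x: "x \<in> D" for x
  proof -
    define \<rho> where "\<rho> h = (u x * u' x h + v x * v' x h) / (r x)^2" for h
    have R: "r x > 0" "(u x)^2 + (v x)^2 > 0" using r0[OF x] r2[of x] by (simp, metis zero_less_power)
    have t: "\<theta>' x h = (v x * u' x h - u x * v' x h) / (r x)^2" for h
      using ang[OF x, of h] R(2) unfolding r2 by (metis less_irrefl nonzero_mult_div_cancel_left)
    have dr: "(r has_derivative (\<lambda>h. \<rho> h * r x)) (at x)"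
    proof -
      have dq: "((\<lambda>x. (u x)^2 + (v x)^2) has_derivative (\<lambda>h. 2 * (u x * u' x h + v x * v' x h))) (at x)"
        by (rule derivative_eq_intros u[OF x] v[OF x] refl)+ (simp add: algebra_simps)
      have "(r has_derivative (\<lambda>h. 2 * (u x * u' x h + v x * v' x h) * (inverse (r x) / 2))) (at x)"
        using DERIV_compose_FDERIV[OF DERIV_real_sqrt[OF R(2)] dq] unfolding r_def[symmetric] .
      moreover have "2 * K * (inverse (r x) / 2) = K / (r x)^2 * r x" for K
        using R(1) by (simp add: field_simps power2_eq_square)
      ultimately show ?thesis unfolding \<rho>_def by (simp only:)
    qed
    have W': "v' x h * cos (\<theta> x) + u' x h * sin (\<theta> x) + \<theta>' x h * (u x * cos (\<theta> x) - v x * sin (\<theta> x)) = \<rho> h * W x" for h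
    proof -
      have "(r x)^2 * (v' x h * cos (\<theta> x) + u' x h * sin (\<theta> x)) + (v x * u' x h - u x * v' x h) * (u x * cos (\<theta> x) - v x * sin (\<theta> x)) = (u x * u' x h + v x * v' x h) * W x"
        unfolding r2 W_def by algebra
      then show ?thesis unfolding t \<rho>_def using R(1) by (simp add: field_simps)
    qed
    have dW: "(W has_derivative (\<lambda>h. \<rho> h * W x)) (at x)"
      unfolding W'[symmetric] unfolding W_def[abs_def]
      by (rule derivative_eq_intros u[OF x] v[OF x] \<theta>[OF x] refl)+ (simp add: algebra_simps)
    show ?thesis
      by (rule has_derivative_eq_rhs[OF has_derivative_divide[OF dW dr]]) (use R in \<open>simp_all add: field_simps\<close>)
  qed
  have Wp: "W p / r p = 1"
  proof -
    have "W p = r p * ((cos (\<theta> p))^2 + (sin (\<theta> p))^2)"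
      using p[folded r_def] unfolding W_def by algebra
    then show ?thesis using r0[OF D(3)] by simp
  qed
  have W: "W x = r x" if x: "x \<in> D" for x
    using has_derivative_zero_unique_connected[OF D(1,2) der x D(3)] Wp r0[OF x] by simp
  have "v x = r x * cos (\<theta> x) \<and> u x = r x * sin (\<theta> x)" if x: "x \<in> D" for x
  proof -
    define W2 where "W2 = u x * cos (\<theta> x) - v x * sin (\<theta> x)"
    have cs: "(cos (\<theta> x))^2 + (sin (\<theta> x))^2 = 1" by simp
    have "(W x)^2 + W2^2 = ((u x)^2 + (v x)^2) * ((cos (\<theta> x))^2 + (sin (\<theta> x))^2)"
      unfolding W_def W2_def by algebra
    then have "W2 = 0" using W[OF x] r2[of x] cs by simp
    moreover have "W x * cos (\<theta> x) - W2 * sin (\<theta> x) = v x * ((cos (\<theta> x))^2 + (sin (\<theta> x))^2)"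
      "W x * sin (\<theta> x) + W2 * cos (\<theta> x) = u x * ((cos (\<theta> x))^2 + (sin (\<theta> x))^2)"
      unfolding W_def W2_def by algebra+
    ultimately show ?thesis using W[OF x] cs by simp
  qed
  then show ?thesis unfolding arctan_branch_def r_def using sm nz by blast
qed

section \<open>Classification of limiting Carleman weights\<close>

lemma lcw_normal_form:
  fixes \<Omega> :: "(real^'n) set"
  assumes n3: "CARD('n) \<ge> 3" and \<Omega>: "open \<Omega>" "connected \<Omega>" "\<Omega> \<noteq> {}" and lcw: "LCW \<Omega> \<phi>"
  shows "\<exists>m x0 a b s X. m \<noteq> 0 \<and> norm a = 1 \<and> norm b = 1 \<and> a \<bullet> b = 0 \<and> s > 0 \<and> model_field a b s X \<and>
           potential \<Omega> (\<lambda>x. m * \<phi> x) (\<lambda>x. X (x - x0))"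
proof -
  define F where "F = lcw_field \<phi>"
  have sm: "smooth_on \<Omega> \<phi>" and nz: "\<And>x. x \<in> \<Omega> \<Longrightarrow> grad \<phi> x \<noteq> 0"
    and umb: "\<And>x V. x \<in> \<Omega> \<Longrightarrow> norm V = norm (grad \<phi> x) \<Longrightarrow> V \<bullet> grad \<phi> x = 0 \<Longrightarrow>
                Hess \<phi> x (grad \<phi> x) (grad \<phi> x) + Hess \<phi> x V V = 0"
    using lcw unfolding LCW_def by auto
  obtain p where p: "p \<in> \<Omega>" using \<Omega>(3) by blast
  have comp: "F x $ k = F x \<bullet> axis k 1" for x k by (simp add: inner_axis)
  have "\<exists>\<alpha> c B \<gamma>. (\<forall>u v. u \<bullet> (B *v v) = - (v \<bullet> (B *v u))) \<and> (\<forall>x\<in>\<Omega>. F x = ckvf \<alpha> c B \<gamma> (x - p))"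
  proof (rule conformal_field_quadratic[OF n3 \<Omega>(1,2) p, where
        \<mu> = "\<lambda>x. - Hess \<phi> x (grad \<phi> x) (grad \<phi> x) / (norm (grad \<phi> x))^4"])
    show "smooth_on \<Omega> (\<lambda>x. F x $ k)" for k
      unfolding comp unfolding F_def by (rule smooth_lcw_field[OF \<Omega>(1) sm nz])
    fix x and i j :: 'n assume x: "x \<in> \<Omega>"
    have "2 * (axis i (1::real) \<bullet> axis j 1) = (if i = j then 2 else 0)" by (simp add: inner_axis_axis)
    then show "dirderiv (axis i 1) (\<lambda>x. F x $ j) x + dirderiv (axis j 1) (\<lambda>x. F x $ i) x =
      - Hess \<phi> x (grad \<phi> x) (grad \<phi> x) / (norm (grad \<phi> x))^4 * (if i = j then 2 else 0)"
      using lcw_field_conformal[OF \<Omega>(1) sm nz x umb[OF x], of "axis i 1" "axis j 1"]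
      unfolding comp unfolding F_def by (simp only:)
  qed
  then obtain \<alpha> c B \<gamma> where skew: "\<And>u v. u \<bullet> (B *v v) = - (v \<bullet> (B *v u))"
    and F: "\<And>x. x \<in> \<Omega> \<Longrightarrow> F x = ckvf \<alpha> c B \<gamma> (x - p)" by blast
  obtain e where e: "e > 0" "ball p e \<subseteq> \<Omega>" using \<Omega>(1) p openE by blast
  have frob: "frobenius_form \<alpha> c B \<gamma> y u v w = 0" if y: "norm y < e" for y u v w
  proof -
    define x where "x = p + y"
    have x: "x \<in> \<Omega>" using e y by (auto simp: x_def dist_norm)
    have D: "dirderiv v (\<lambda>x. F x \<bullet> w) x
       = ((\<alpha> \<bullet> v) *\<^sub>R y + (\<alpha> \<bullet> y) *\<^sub>R v - (y \<bullet> v) *\<^sub>R \<alpha> + c *\<^sub>R v + B *v v) \<bullet> w" for v w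
    proof -
      have "((\<lambda>x. ckvf \<alpha> c B \<gamma> (x - p)) has_derivative
        (\<lambda>v. (\<alpha> \<bullet> v) *\<^sub>R y + (\<alpha> \<bullet> y) *\<^sub>R v - (y \<bullet> v) *\<^sub>R \<alpha> + c *\<^sub>R v + B *v v)) (at x)"
        using has_derivative_shift[where a = "- p" and x = x, OF has_derivative_ckvf[of \<alpha> c B \<gamma>]]
        by (simp add: x_def)
      then have *: "((\<lambda>x. ckvf \<alpha> c B \<gamma> (x - p) \<bullet> w) has_derivative
        (\<lambda>v. ((\<alpha> \<bullet> v) *\<^sub>R y + (\<alpha> \<bullet> y) *\<^sub>R v - (y \<bullet> v) *\<^sub>R \<alpha> + c *\<^sub>R v + B *v v) \<bullet> w)) (at x)"
        by (rule has_derivative_inner_left)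
      show ?thesis
        unfolding dirderiv_eqI[OF *, symmetric]
        by (rule dirderiv_cong[OF \<Omega>(1) x])
           (simp_all add: F smooth_on_differentiable[OF smooth_lcw_field[OF \<Omega>(1) sm nz] x, folded F_def])
    qed
    have d: "dirderiv v (\<lambda>x. F x \<bullet> w) x - dirderiv w (\<lambda>x. F x \<bullet> v) x = 2 * curl_form \<alpha> B y v w" for v w
      unfolding D curl_form_def
      by (simp add: inner_add_left inner_diff_left inner_commute[of w v]
          inner_commute[of "B *v v" w] inner_commute[of "B *v w" v] skew[of v w])
    have X: "F x = ckvf \<alpha> c B \<gamma> y" using F[OF x] by (simp add: x_def)
    show ?thesis
      using lcw_field_integrable[OF \<Omega>(1) sm nz x, of u v w, folded F_def]
      unfolding d X frobenius_form_def by (simp add: algebra_simps)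
  qed
  have FF: "F x \<noteq> 0" "grad \<phi> x = (1 / (F x \<bullet> F x)) *\<^sub>R F x" if x: "x \<in> \<Omega>" for x
    using nz[OF x] by (simp_all add: F_def lcw_field_def power2_norm_eq_inner)
  have "ckvf \<alpha> c B \<gamma> 0 \<noteq> 0" using FF(1)[OF p] F[OF p] by simp
  from integrable_ckvf_normal_form[OF n3 skew e(1) frob this]
  obtain m h a b s X where nf: "m \<noteq> 0" "norm a = 1" "norm b = 1" "a \<bullet> b = 0" "s > 0" "model_field a b s X"
    and X: "\<And>y. ckvf \<alpha> c B \<gamma> y = m *\<^sub>R X (y - h)" by blast
  have "potential \<Omega> (\<lambda>x. m * \<phi> x) (\<lambda>x. X (x - (p + h)))"
    unfolding potential_def
  proof
    fix x assume x: "x \<in> \<Omega>"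
    have Fx: "F x = m *\<^sub>R X (x - (p + h))"
      using F[OF x] X[of "x - p"] by (simp add: diff_diff_eq)
    have "(\<phi> has_derivative (\<lambda>v. (1 / (F x \<bullet> F x)) *\<^sub>R F x \<bullet> v)) (at x)"
      using has_derivative_dirderiv[OF smooth_on_differentiable[OF sm x]] dirderiv_eq_grad[OF smooth_on_differentiable[OF sm x]]
      by (simp add: FF(2)[OF x])
    then have "((\<lambda>x. m * \<phi> x) has_derivative (\<lambda>v. m * ((1 / (F x \<bullet> F x)) *\<^sub>R F x \<bullet> v))) (at x)"
      by (rule has_derivative_mult_right)
    moreover have "m * ((1 / (F x \<bullet> F x)) *\<^sub>R F x \<bullet> v) = (X (x - (p + h)) \<bullet> v) / (X (x - (p + h)) \<bullet> X (x - (p + h)))" for v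
      unfolding Fx using nf(1) by simp
    ultimately show "X (x - (p + h)) \<noteq> 0 \<and> ((\<lambda>x. m * \<phi> x) has_derivative (\<lambda>v. (X (x - (p + h)) \<bullet> v) / (X (x - (p + h)) \<bullet> X (x - (p + h))))) (at x)"
      using FF(1)[OF x] Fx by auto
  qed
  then show ?thesis using nf by blast
qed

lemma potential_translate:
  assumes "potential \<Omega> f (\<lambda>x. X (x - x0))"
  shows "potential ((\<lambda>x. x - x0) ` \<Omega>) (\<lambda>y. f (y + x0)) X"
  unfolding potential_def
proof
  fix y assume "y \<in> (\<lambda>x. x - x0) ` \<Omega>"
  then have "y + x0 \<in> \<Omega>" by auto
  then have X: "X y \<noteq> 0" and d: "(f has_derivative (\<lambda>v. (X y \<bullet> v) / (X y \<bullet> X y))) (at (y + x0))"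
    using assms unfolding potential_def by (metis add_diff_cancel_right')+
  have "((\<lambda>y. f (y + x0)) has_derivative (\<lambda>v. (X y \<bullet> v) / (X y \<bullet> X y))) (at y)"
    by (rule has_derivative_shift[OF d])
  then show "X y \<noteq> 0 \<and> ((\<lambda>y. f (y + x0)) has_derivative (\<lambda>v. (X y \<bullet> v) / (X y \<bullet> X y))) (at y)"
    using X by blast
qed

lemma potential_unique:
  assumes "open S" "connected S" "potential S f X" "potential S g X" "S \<noteq> {}"
  shows "\<exists>b. \<forall>y\<in>S. f y = g y + b"
proof -
  obtain p where p: "p \<in> S" using assms(5) by blast
  have "((\<lambda>y. f y - g y) has_derivative (\<lambda>v. 0)) (at y)" if "y \<in> S" for y
    using has_derivative_diff[of f _ "at y" g] assms(3,4) that unfolding potential_def by fastforce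
  then have "f y - g y = f p - g p" if "y \<in> S" for y
    using has_derivative_zero_unique_connected[OF assms(1,2) _ that p] by blast
  then show ?thesis by (intro exI[of _ "f p - g p"]) (auto simp: algebra_simps)
qed

lemma angle_exists:
  assumes "\<not> (u = 0 \<and> v = 0)"
  shows "\<exists>t. v = sqrt (u^2 + v^2) * cos t \<and> u = sqrt (u^2 + v^2) * sin t"
proof -
  define r where "r = sqrt (u^2 + v^2)"
  have r: "r > 0" "r^2 = u^2 + v^2" using assms by (simp_all add: r_def sum_power2_gt_zero_iff)
  have "(v / r)^2 + (u / r)^2 = 1"
  proof -
    have "(v / r)^2 + (u / r)^2 = (u^2 + v^2) / r^2"
      by (simp add: power_divide add_divide_distrib)
    then show ?thesis using r(1) unfolding r(2)[symmetric] by simp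
  qed
  then obtain t where "v / r = cos t" "u / r = sin t" using sincos_total_2pi by metis
  then show ?thesis using r(1) unfolding r_def[symmetric] by (intro exI[of _ t]) (auto simp: field_simps)
qed

text \<open>Any potential of a field \<open>X\<close> proportional to \<open>v \<nabla>u - u \<nabla>v\<close>, with \<open>|X|\<^sup>2\<close> proportional to \<open>u\<^sup>2 + v\<^sup>2\<close>, is up to
  an affine change a branch of the angle; the shift \<open>b\<close> adjusts its value at a single point. This provides
  the branch on the domain of the potential, however it winds around the zeros of \<open>X\<close>.\<close>

lemma smooth_potential_arctan_branch:
  fixes u v f :: "real^'n \<Rightarrow> real"
  assumes D: "open D" "connected D" "D \<noteq> {}" and f: "smooth_on D f" "potential D f X"
    and u: "\<And>x. (u has_derivative u' x) (at x)" and v: "\<And>x. (v has_derivative v' x) (at x)"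
    and k: "k \<noteq> 0" and K: "K > 0"
    and norm: "\<And>x. K * (X x \<bullet> X x) = (u x)^2 + (v x)^2"
    and ang: "\<And>x h. K * (k * (X x \<bullet> h)) = v x * u' x h - u x * v' x h"
  shows "\<exists>b. arctan_branch D u v (\<lambda>x. k * (f x - b))"
proof -
  obtain p where p: "p \<in> D" using D(3) by blast
  have X0: "X x \<noteq> 0" if "x \<in> D" for x using f(2) that by (simp add: potential_def)
  have nz: "\<not> (u x = 0 \<and> v x = 0)" if "x \<in> D" for x
    using norm[of x] K X0[OF that] by auto
  obtain t where t: "v p = sqrt ((u p)^2 + (v p)^2) * cos t" "u p = sqrt ((u p)^2 + (v p)^2) * sin t"
    using angle_exists[OF nz[OF p]] by blast
  define b where "b = f p - t / k"
  have kt: "k * (f p - b) = t" using k by (simp add: b_def)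
  have "smooth_on D (\<lambda>x. k * (f x + - b))"
    by (intro smooth_on_mult smooth_on_add smooth_on_const f D)
  then have sm: "smooth_on D (\<lambda>x. k * (f x - b))" by simp
  have "arctan_branch D u v (\<lambda>x. k * (f x - b))"
  proof (rule arctan_branchI[OF D(1,2) p sm u v, where \<theta>' = "\<lambda>x h. k * ((X x \<bullet> h) / (X x \<bullet> X x))"])
    fix x assume x: "x \<in> D"
    have "(f has_derivative (\<lambda>v. (X x \<bullet> v) / (X x \<bullet> X x))) (at x)"
      using f(2) x by (simp add: potential_def)
    from has_derivative_mult_right[OF has_derivative_diff[OF this has_derivative_const[of b]], of k]
    show "((\<lambda>x. k * (f x - b)) has_derivative (\<lambda>h. k * ((X x \<bullet> h) / (X x \<bullet> X x)))) (at x)"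
      by simp
    show "((u x)^2 + (v x)^2) * (k * ((X x \<bullet> h) / (X x \<bullet> X x))) = v x * u' x h - u x * v' x h" for h
      unfolding norm[symmetric] ang[symmetric] using X0[OF x] by simp
  qed (use nz t kt in auto)
  then show ?thesis by blast
qed

theorem theorem1p1:
  fixes \<Omega> :: "(real^'n) set" and \<phi> :: "real^'n \<Rightarrow> real"
  assumes "CARD('n) \<ge> 3"
    and "open \<Omega>" and "connected \<Omega>" and "\<Omega> \<noteq> {}"
    and "LCW \<Omega> \<phi>"
  shows "\<exists>(a::real) (b::real) (x0::real^'n) (\<gamma>::real^'n) (\<sigma>::real^'n) (s::real) D \<psi> X.
           a \<noteq> 0 \<and> norm \<gamma> = 1 \<and> norm \<sigma> = 1 \<and> \<gamma> \<bullet> \<sigma> = 0 \<and> s > 0 \<and>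
           model_weight \<gamma> \<sigma> s D \<psi> X \<and>
           open D \<and> (\<forall>x\<in>\<Omega>. x - x0 \<in> D \<and> \<phi> x = a * \<psi> (x - x0) + b) \<and>
           (\<forall>y\<in>D. \<psi> differentiable (at y) \<and> grad \<psi> y \<noteq> 0 \<and>
                  X y = (1 / (norm (grad \<psi> y))^2) *\<^sub>R grad \<psi> y)"
proof -
  obtain m x0 \<gamma> \<sigma> s X where m: "m \<noteq> 0"
    and par: "norm \<gamma> = 1" "norm \<sigma> = 1" "\<gamma> \<bullet> \<sigma> = 0" "s > 0"
    and X: "model_field \<gamma> \<sigma> s X" and pot: "potential \<Omega> (\<lambda>x. m * \<phi> x) (\<lambda>x. X (x - x0))"
    using lcw_normal_form[OF assms] by blast
  define S where "S = (\<lambda>x. x - x0) ` \<Omega>"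
  define f where "f y = m * \<phi> (y + x0)" for y
  have S: "open S" "connected S" "S \<noteq> {}"
    using assms(2-4) unfolding S_def
    by (auto intro!: open_translation_subtract connected_continuous_image continuous_intros)
  have f: "potential S f X"
    using potential_translate[OF pot] unfolding S_def f_def[abs_def] .
  have smf: "smooth_on S f"
    unfolding f_def[abs_def] S_def using assms(2,5) unfolding LCW_def
    by (intro smooth_on_mult smooth_on_const smooth_on_translate open_translation_subtract) auto
  have \<phi>f: "x - x0 \<in> S" "\<phi> x = 1 / m * f (x - x0)" if "x \<in> \<Omega>" for x
    using that m by (auto simp: S_def f_def)
  \<comment> \<open>On \<open>S\<close>, which is connected, \<open>f\<close> differs by a constant from every potential of \<open>X\<close>.\<close>
  have fin: ?thesis if D: "open D" "S \<subseteq> D" and \<psi>: "potential D \<psi> X" "model_weight \<gamma> \<sigma> s D \<psi> X" for D \<psi>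
  proof -
    have "potential S \<psi> X" using \<psi>(1) D(2) unfolding potential_def by blast
    then obtain b where b: "\<And>y. y \<in> S \<Longrightarrow> f y = \<psi> y + b"
      using potential_unique[OF S(1,2) f _ S(3)] by blast
    have "\<forall>x\<in>\<Omega>. x - x0 \<in> D \<and> \<phi> x = 1 / m * \<psi> (x - x0) + b / m"
      using \<phi>f b D(2) by (auto simp: add_divide_distrib)
    moreover have "\<forall>y\<in>D. \<psi> differentiable (at y) \<and> grad \<psi> y \<noteq> 0 \<and>
        X y = (1 / (norm (grad \<psi> y))^2) *\<^sub>R grad \<psi> y"
      using potential_grad[OF \<psi>(1)] by blast
    moreover have "1 / m \<noteq> 0" using m by simp
    ultimately show ?thesis using par D(1) \<psi>(2) by blast
  qed
  have shift: "potential S (\<lambda>y. f y - b) X" for b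
    unfolding potential_def
  proof
    fix y assume "y \<in> S"
    then have "X y \<noteq> 0" "(f has_derivative (\<lambda>v. (X y \<bullet> v) / (X y \<bullet> X y))) (at y)"
      using f by (auto simp: potential_def)
    then show "X y \<noteq> 0 \<and> ((\<lambda>y. f y - b) has_derivative (\<lambda>v. (X y \<bullet> v) / (X y \<bullet> X y))) (at y)"
      using has_derivative_diff[OF _ has_derivative_const[of b]] by fastforce
  qed
  have SX: "X y \<noteq> 0" if "y \<in> S" for y using f that by (simp add: potential_def)
  have \<gamma>\<sigma>: "\<gamma> \<bullet> \<gamma> = 1" "\<sigma> \<bullet> \<sigma> = 1" "\<sigma> \<bullet> \<gamma> = 0" using par by (simp_all add: norm_eq_1 inner_commute)
  consider "X = ckvf 0 0 0 \<gamma>" | "X = ckvf 0 1 0 0" | "X = ckvf 0 0 (wedge \<gamma> \<sigma>) 0"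
    | "X = ckvf \<gamma> 0 0 0" | "X = ckvf \<gamma> 0 0 ((s/2) *\<^sub>R \<gamma>)" | "X = ckvf \<gamma> 0 0 (- (s/2) *\<^sub>R \<gamma>)"
    using X unfolding model_field_def by blast
  then show ?thesis
  proof cases
    case 1
    show ?thesis
      by (rule fin[of UNIV "\<lambda>x. \<gamma> \<bullet> x"])
         (simp_all add: 1 potential_linear par(1) model_weight_def)
  next
    case 2
    have "0 \<notin> S" using SX[of 0] by (auto simp: 2 ckvf_def)
    then show ?thesis
      by (intro fin[of "- {0}" "\<lambda>x. ln (norm x)"])
         (auto simp: 2 potential_ln_norm model_weight_def)
  next
    case 3
    \<comment> \<open>In this case and the fifth one, the model is \<open>f\<close> itself up to a constant, with domain \<open>S\<close>.\<close>
    have X3: "X x = (\<sigma> \<bullet> x) *\<^sub>R \<gamma> - (\<gamma> \<bullet> x) *\<^sub>R \<sigma>" for x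
      by (simp add: 3 ckvf_def wedge_vector_mult)
    have "\<exists>b. arctan_branch S (\<lambda>x. \<gamma> \<bullet> x) (\<lambda>x. \<sigma> \<bullet> x) (\<lambda>x. 1 * (f x - b))"
    proof (rule smooth_potential_arctan_branch[OF S smf f, where K = 1])
      show "1 * (X x \<bullet> X x) = (\<gamma> \<bullet> x)\<^sup>2 + (\<sigma> \<bullet> x)\<^sup>2" for x
        unfolding X3 using \<gamma>\<sigma> par(3)
        by (simp add: inner_diff_left inner_diff_right power2_eq_square)
      show "1 * (1 * (X x \<bullet> h)) = (\<sigma> \<bullet> x) * (\<gamma> \<bullet> h) - (\<gamma> \<bullet> x) * (\<sigma> \<bullet> h)" for x h
        unfolding X3 by (simp add: inner_diff_left)
    qed (auto intro!: derivative_eq_intros)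
    then obtain b where "arctan_branch S (\<lambda>x. \<gamma> \<bullet> x) (\<lambda>x. \<sigma> \<bullet> x) (\<lambda>x. f x - b)" by auto
    then show ?thesis
      by (intro fin[OF S(1) order_refl shift[of b]]) (simp add: model_weight_def 3)
  next
    case 4
    have "0 \<notin> S" using SX[of 0] by (auto simp: 4 ckvf_def)
    then show ?thesis
      by (intro fin[OF _ _ potential_inversion[OF par(1), folded 4]])
         (auto simp: 4 model_weight_def)
  next
    case 5
    have q: "sqrt s > 0" "sqrt s * sqrt s = s" using par(4) by simp_all
    have "\<exists>b. arctan_branch S (\<lambda>x. - 2 * (\<gamma> \<bullet> x) / sqrt s) (\<lambda>x. (norm x)^2 / s - 1) (\<lambda>x. sqrt s * (f x - b))"
    proof (rule smooth_potential_arctan_branch[OF S smf f, where K = "4 / s^2" and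
          u' = "\<lambda>x h. - 2 * (\<gamma> \<bullet> h) / sqrt s" and v' = "\<lambda>x h. 2 * (x \<bullet> h) / s"])
      show "4 / s^2 * (X x \<bullet> X x) = (- 2 * (\<gamma> \<bullet> x) / sqrt s)^2 + ((norm x)^2 / s - 1)^2" for x
        unfolding 5 ckvf_parallel_norm[OF par(1)] power2_norm_eq_inner using par(4)
        by (simp add: power_divide power_mult_distrib) (simp add: field_simps power2_eq_square)
      show "4 / s^2 * (sqrt s * (X x \<bullet> h)) = ((norm x)^2 / s - 1) * (- 2 * (\<gamma> \<bullet> h) / sqrt s) - (- 2 * (\<gamma> \<bullet> x) / sqrt s) * (2 * (x \<bullet> h) / s)" for x h
      proof -
        have alg: "4 / (q * q)^2 * (q * (T * P - 1/2 * N * G + q * q / 2 * G)) = (N / (q * q) - 1) * (- 2 * G / q) - (- 2 * T / q) * (2 * P / (q * q))"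
          if "q > 0" for q T P N G :: real
          using that by (simp add: field_simps power2_eq_square)
        show ?thesis
          using alg[OF q(1), of "\<gamma> \<bullet> x" "x \<bullet> h" "x \<bullet> x" "\<gamma> \<bullet> h"]
          unfolding q(2) 5 ckvf_inner power2_norm_eq_inner by simp
      qed
      show "((\<lambda>x. - 2 * (\<gamma> \<bullet> x) / sqrt s) has_derivative (\<lambda>h. - 2 * (\<gamma> \<bullet> h) / sqrt s)) (at x)" for x
        using q by (auto intro!: derivative_eq_intros simp: fun_eq_iff field_simps)
      show "((\<lambda>x. (norm x)^2 / s - 1) has_derivative (\<lambda>h. 2 * (x \<bullet> h) / s)) (at x)" for x
        unfolding power2_norm_eq_inner using par(4) by (auto intro!: derivative_eq_intros simp: inner_commute)
    qed (use par(4) in auto)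
    then obtain b where b: "arctan_branch S (\<lambda>x. - 2 * (\<gamma> \<bullet> x) / sqrt s) (\<lambda>x. (norm x)^2 / s - 1) (\<lambda>x. sqrt s * (f x - b))" by blast
    have "(\<lambda>x. f x - b) = (\<lambda>x. 1 / sqrt s * (sqrt s * (f x - b)))" using par(4) by simp
    then show ?thesis
      using b 5 by (intro fin[OF S(1) order_refl shift[of b]]) (unfold model_weight_def, blast)
  next
    case 6
    define w where "w x = (- 2 * (\<gamma> \<bullet> x) / sqrt s) / ((norm x)^2 / s + 1)" for x
    have dom: "\<bar>w y\<bar> < 1 \<longleftrightarrow> X y \<noteq> 0" for y
      unfolding w_def 6 by (rule artanh_domain[OF par(1,4)])
    have pot6: "potential {x. \<bar>w x\<bar> < 1} (\<lambda>x. 1 / sqrt s * artanh (w x)) X"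
      unfolding w_def 6 by (rule potential_artanh[OF par(1,4)])
    have "continuous_on UNIV X"
      unfolding 6 by (rule has_derivative_continuous_on[OF has_derivative_at_withinI[OF has_derivative_ckvf]])
    then have "open {x. X x \<noteq> 0}" using open_Collect_neq[of X "\<lambda>_. 0"] by simp
    then have "open {x. \<bar>w x\<bar> < 1}" unfolding dom .
    moreover have "model_weight \<gamma> \<sigma> s {x. \<bar>w x\<bar> < 1} (\<lambda>x. 1 / sqrt s * artanh (w x)) X"
      unfolding model_weight_def w_def 6 by (intro disjI2 conjI refl)
    moreover have "S \<subseteq> {x. \<bar>w x\<bar> < 1}" using SX dom by blast
    ultimately show ?thesis using fin[OF _ _ pot6] by blast
  qed
qed

end
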